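(* Let $\mathcal C$ be a class of real Banach spaces of dimension at least 2 in which the implication $$u\perp_B v\ \Longrightarrow\ u-v\perp_B u+v\qquad (u,v\in S_X)$$ characterizes inner product spaces, i.e. for every $X\in\mathcal C$ this implication holds for all $u,v\in S_X$ if and only if the norm of $X$ is induced by an inner product. Then for every $X\in\mathcal C$, $$\mathrm{DR}_B(X)=1\iff X\text{ is a Hilbert space}.$$ In particular, this equivalence holds for every smooth two-dimensional Radon plane $X$.
   Context: $S_X$ is the unit sphere of $X$. Birkhoff orthogonality: $x\perp_B y$ iff $\|x+\lambda y\|\ge\|x\|$ for all $\lambda\in\mathbb R$. For nonzero $x,y\in X$ put $\alpha[x,y]=\left\|\frac{x}{\|x\|}-\frac{y}{\|y\|}\right\|$ and $\beta[x,y]=\left\|\frac{x}{\|y\|}-\frac{y}{\|x\|}\right\|$. The Birkhoff-orthogonal Dehghan--Rooin constant is $$\mathrm{DR}_B(X)=\sup\left\{\frac{\alpha[x,y]}{\beta[x,y]}: x,y\in X\setminus\{0\},\ x\perp_B y,\ \beta[x,y]\ne 0\right\}.$$ A Radon plane is a two-dimensional real normed space in which Birkhoff orthogonality is a symmetric relation. *)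

theory Defs
  imports Complex_Main
begin

(* A normed space is a pair (V, nrm): V is a linear subspace of an ambient real vector space and
   nrm is a norm on V.  Only the values of nrm on V matter.  A single type thus hosts spaces of
   different dimensions and with different norms, so that a class of spaces is a set of such
   pairs; every family of normed spaces lives in some ambient type (a large enough direct sum). *)

locale normed_space_on =
  fixes V :: "'a::real_vector set" and nrm :: "'a \<Rightarrow> real"
  assumes subspace_V: "subspace V"
    and nrm_eq_zero: "x \<in> V \<Longrightarrow> nrm x = 0 \<longleftrightarrow> x = 0"
    and nrm_scaleR: "x \<in> V \<Longrightarrow> nrm (c *\<^sub>R x) = \<bar>c\<bar> * nrm x"
    and nrm_triangle: "x \<in> V \<Longrightarrow> y \<in> V \<Longrightarrow> nrm (x + y) \<le> nrm x + nrm y"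

locale banach_space_on = normed_space_on +
  assumes complete_V:
    "\<lbrakk>\<And>n. s n \<in> V; \<And>e. e > 0 \<Longrightarrow> \<exists>N. \<forall>m\<ge>N. \<forall>n\<ge>N. nrm (s m - s n) < e\<rbrakk>
      \<Longrightarrow> \<exists>l\<in>V. (\<lambda>n. nrm (s n - l)) \<longlonglongrightarrow> 0"

(* Not "2 <= dim V": the library's dim is 0 on infinite-dimensional spaces. *)
definition dim_at_least_2 :: "'a::real_vector set \<Rightarrow> bool" where
  "dim_at_least_2 V \<longleftrightarrow> (\<exists>B\<subseteq>V. independent B \<and> card B = 2)"

definition inner_product_on :: "'a::real_vector set \<Rightarrow> ('a \<Rightarrow> 'a \<Rightarrow> real) \<Rightarrow> bool" where
  "inner_product_on V ip \<longleftrightarrow>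
     (\<forall>x\<in>V. \<forall>y\<in>V. ip x y = ip y x) \<and>
     (\<forall>x\<in>V. \<forall>y\<in>V. \<forall>z\<in>V. ip (x + y) z = ip x z + ip y z) \<and>
     (\<forall>x\<in>V. \<forall>y\<in>V. \<forall>c. ip (c *\<^sub>R x) y = c * ip x y) \<and>
     (\<forall>x\<in>V. x \<noteq> 0 \<longrightarrow> ip x x > 0)"

definition norm_induced_by_inner_product :: "'a::real_vector set \<Rightarrow> ('a \<Rightarrow> real) \<Rightarrow> bool" where
  "norm_induced_by_inner_product V nrm \<longleftrightarrow>
     (\<exists>ip. inner_product_on V ip \<and> (\<forall>x\<in>V. nrm x = sqrt (ip x x)))"

definition hilbert_space_on :: "'a::real_vector set \<Rightarrow> ('a \<Rightarrow> real) \<Rightarrow> bool" where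
  "hilbert_space_on V nrm \<longleftrightarrow> banach_space_on V nrm \<and> norm_induced_by_inner_product V nrm"

definition unit_sphere :: "'a::real_vector set \<Rightarrow> ('a \<Rightarrow> real) \<Rightarrow> 'a set" where
  "unit_sphere V nrm = {x \<in> V. nrm x = 1}"

definition birkhoff_orth :: "('a::real_vector \<Rightarrow> real) \<Rightarrow> 'a \<Rightarrow> 'a \<Rightarrow> bool" where
  "birkhoff_orth nrm x y \<longleftrightarrow> (\<forall>l::real. nrm (x + l *\<^sub>R y) \<ge> nrm x)"

definition DR_alpha :: "('a::real_vector \<Rightarrow> real) \<Rightarrow> 'a \<Rightarrow> 'a \<Rightarrow> real" where
  "DR_alpha nrm x y = nrm (x /\<^sub>R nrm x - y /\<^sub>R nrm y)"

definition DR_beta :: "('a::real_vector \<Rightarrow> real) \<Rightarrow> 'a \<Rightarrow> 'a \<Rightarrow> real" where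
  "DR_beta nrm x y = nrm (x /\<^sub>R nrm y - y /\<^sub>R nrm x)"

(* The real-valued Sup is a genuine supremum when dim V >= 2: orthogonal pairs exist, and for
   t = nrm x / nrm y one has alpha <= 2 and beta >= max t (1/t - t) >= 1 / sqrt 2. *)
definition DR_B :: "'a::real_vector set \<Rightarrow> ('a \<Rightarrow> real) \<Rightarrow> real" where
  "DR_B V nrm = Sup {DR_alpha nrm x y / DR_beta nrm x y | x y.
     x \<in> V - {0} \<and> y \<in> V - {0} \<and> birkhoff_orth nrm x y \<and> DR_beta nrm x y \<noteq> 0}"

definition radon_plane :: "'a::real_vector set \<Rightarrow> ('a \<Rightarrow> real) \<Rightarrow> bool" where
  "radon_plane V nrm \<longleftrightarrow> normed_space_on V nrm \<and> dim V = 2 \<and>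
     (\<forall>x\<in>V. \<forall>y\<in>V. birkhoff_orth nrm x y \<longrightarrow> birkhoff_orth nrm y x)"

(* For x in the unit sphere: the functionals f on V of norm 1 with f x = 1. *)
definition supporting_functional ::
    "'a::real_vector set \<Rightarrow> ('a \<Rightarrow> real) \<Rightarrow> 'a \<Rightarrow> ('a \<Rightarrow> real) \<Rightarrow> bool" where
  "supporting_functional V nrm x f \<longleftrightarrow>
     (\<forall>y\<in>V. \<forall>z\<in>V. f (y + z) = f y + f z) \<and>
     (\<forall>y\<in>V. \<forall>c. f (c *\<^sub>R y) = c * f y) \<and>
     (\<forall>y\<in>V. \<bar>f y\<bar> \<le> nrm y) \<and> f x = 1"

(* Existence of a supporting functional is Hahn-Banach, so smoothness is its uniqueness on V. *)
definition smooth_space :: "'a::real_vector set \<Rightarrow> ('a \<Rightarrow> real) \<Rightarrow> bool" where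
  "smooth_space V nrm \<longleftrightarrow>
     (\<forall>x\<in>unit_sphere V nrm. \<forall>f g.
        supporting_functional V nrm x f \<and> supporting_functional V nrm x g
          \<longrightarrow> (\<forall>y\<in>V. f y = g y))"

end

(* Write z = u - v and w = u + v for unit vectors u, v with u orthogonal to v.  The vectors
   t u - v/t are the combinations cosh(a) z + sinh(a) w, so DR_B = 1 says that their norm is at
   least that of z; by convexity this means that z is orthogonal to w.

   In a smooth Radon plane let J u be the positively oriented unit vector orthogonal to u, and scale
   the area form so that u and J u always span area 1.  If u - J u is orthogonal to u + J u, then
   the product of their norms is 2, and passing from u to the direction of u + J u brings the
   norm of u + J u strictly closer to sqrt 2.  Since every direction is reached, that norm is
   constantly sqrt 2.  It follows that along the unit circle, parametrized by area, u' = J u and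
   (J u)' = - u, so the unit circle is an ellipse. *)

theory Submission
  imports Defs "HOL-Analysis.Analysis"
begin

subsection \<open>The constant in terms of Birkhoff orthogonality\<close>

text \<open>The obstacle in the plane is regularity: smoothness makes \<open>J\<close> well defined
  and continuous, but nothing is known beforehand about differentiability of u \<mapsto> J u.
  Derivatives are therefore extracted from areas of increments. For nearby unit vectors u and u',
  the mixed areas of u, J u' and of u', J u are at most the area of u, J u. The Pluecker relation
  then bounds their variation by the product of the areas of u, u' and of J u, J u', which is of
  higher order. This is used twice: for the constancy of the area of u and J u, and, once the norm
  of u + J u is constant, for the derivative of J u. The strict approach to sqrt 2 has this source:
  if r is the norm of u + J u, then the new sum has coordinates 1/r - r/2 and 1/r + r/2 along u and
  J u. Their absolute values add up to max(r, 2/r), and strict convexity, a consequence of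
  smoothness, makes the norm smaller unless the first coordinate vanishes, that is, unless r = sqrt
  2.\<close>

context normed_space_on
begin

section \<open>Norm and Birkhoff orthogonality on a subspace\<close>

lemma V_closed [simp]:
  "0 \<in> V" "x \<in> V \<Longrightarrow> c *\<^sub>R x \<in> V" "x \<in> V \<Longrightarrow> - x \<in> V"
  "x \<in> V \<Longrightarrow> y \<in> V \<Longrightarrow> x + y \<in> V" "x \<in> V \<Longrightarrow> y \<in> V \<Longrightarrow> x - y \<in> V"
  using subspace_V by (simp_all add: subspace_0 subspace_scale subspace_neg subspace_add subspace_diff)

lemma nrm_zero [simp]: "nrm 0 = 0"
  using nrm_eq_zero by simp

lemma nrm_minus: "x \<in> V \<Longrightarrow> nrm (- x) = nrm x"
  using nrm_scaleR[of x "-1"] by simp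

lemma nrm_nonneg: "x \<in> V \<Longrightarrow> 0 \<le> nrm x"
  using nrm_triangle[of x "- x"] nrm_minus[of x] by simp

lemma nrm_pos: "x \<in> V \<Longrightarrow> x \<noteq> 0 \<Longrightarrow> 0 < nrm x"
  using nrm_nonneg[of x] nrm_eq_zero[of x] by linarith

lemma nrm_diff_le: "x \<in> V \<Longrightarrow> y \<in> V \<Longrightarrow> nrm (x - y) \<le> nrm x + nrm y"
  using nrm_triangle[of x "- y"] nrm_minus[of y] by simp

lemma nrm_minus_commute: "x \<in> V \<Longrightarrow> y \<in> V \<Longrightarrow> nrm (x - y) = nrm (y - x)"
  using nrm_minus[of "x - y"] by simp

lemma nrm_abs_diff_le: "x \<in> V \<Longrightarrow> y \<in> V \<Longrightarrow> \<bar>nrm x - nrm y\<bar> \<le> nrm (x - y)"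
  using nrm_triangle[of "x - y" y] nrm_triangle[of "y - x" x] nrm_minus_commute[of x y] by simp

lemma birkhoff_orth_scaleR:
  assumes "x \<in> V" "y \<in> V" "birkhoff_orth nrm x y"
  shows "birkhoff_orth nrm (a *\<^sub>R x) (b *\<^sub>R y)"
  unfolding birkhoff_orth_def
proof
  fix l :: real
  show "nrm (a *\<^sub>R x) \<le> nrm (a *\<^sub>R x + l *\<^sub>R b *\<^sub>R y)"
  proof (cases "a = 0")
    case True
    then show ?thesis using assms nrm_nonneg by simp
  next
    case False
    have "a *\<^sub>R x + l *\<^sub>R b *\<^sub>R y = a *\<^sub>R (x + (l * b / a) *\<^sub>R y)"
      using False by (simp add: algebra_simps)
    then have "nrm (a *\<^sub>R x + l *\<^sub>R b *\<^sub>R y) = \<bar>a\<bar> * nrm (x + (l * b / a) *\<^sub>R y)"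
      using assms by (simp add: nrm_scaleR)
    also have "\<dots> \<ge> \<bar>a\<bar> * nrm x"
      using assms(3) unfolding birkhoff_orth_def by (intro mult_left_mono) auto
    finally show ?thesis using assms by (simp add: nrm_scaleR)
  qed
qed

lemma birkhoff_orth_le:
  assumes "x \<in> V" "y \<in> V" "birkhoff_orth nrm x y"
  shows "\<bar>a\<bar> * nrm x \<le> nrm (a *\<^sub>R x + b *\<^sub>R y)"
proof -
  have "birkhoff_orth nrm (a *\<^sub>R x) (b *\<^sub>R y)" using assms by (rule birkhoff_orth_scaleR)
  then have "nrm (a *\<^sub>R x) \<le> nrm (a *\<^sub>R x + 1 *\<^sub>R (b *\<^sub>R y))"
    unfolding birkhoff_orth_def by blast
  then show ?thesis using assms by (simp add: nrm_scaleR)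
qed

text \<open>A foot is a minimum point of the norm on the line \<open>x + l *\<^sub>R y\<close>. The
  norm is Lipschitz in \<open>l\<close>, and for \<open>\<bar>l\<bar> > K\<close> the triangle
  inequality keeps it at least at its value for \<open>l = 0\<close>, so the minimum over
  \<open>{-K..K}\<close> is global.\<close>

lemma exists_birkhoff_foot:
  assumes x: "x \<in> V" and y: "y \<in> V" "y \<noteq> 0"
  obtains l where "birkhoff_orth nrm (x + l *\<^sub>R y) y"
proof -
  define f where "f l = nrm (x + l *\<^sub>R y)" for l
  have py: "0 < nrm y" using nrm_pos y by blast
  have "(nrm y)-lipschitz_on UNIV f"
  proof (rule lipschitz_onI)
    fix a b :: real
    have "(x + a *\<^sub>R y) - (x + b *\<^sub>R y) = (a - b) *\<^sub>R y" by (simp add: algebra_simps)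
    then have "\<bar>f a - f b\<bar> \<le> nrm ((a - b) *\<^sub>R y)"
      using nrm_abs_diff_le[of "x + a *\<^sub>R y" "x + b *\<^sub>R y"] x y by (simp add: f_def)
    then show "dist (f a) (f b) \<le> nrm y * dist a b"
      using y by (simp add: dist_real_def nrm_scaleR mult.commute)
  qed (use py in simp)
  then have cont: "continuous_on UNIV f" by (rule lipschitz_on_continuous_on)
  define K where "K = 2 * nrm x / nrm y"
  have K0: "0 \<le> K" using nrm_nonneg[OF x] py by (simp add: K_def)
  obtain l where l: "l \<in> {-K..K}" "\<And>m. m \<in> {-K..K} \<Longrightarrow> f l \<le> f m"
    using continuous_attains_inf[of "{-K..K}" f] K0 continuous_on_subset[OF cont] by auto
  have "f l \<le> f m" for m
  proof (cases "m \<in> {-K..K}")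
    case False
    then have "K < \<bar>m\<bar>" by auto
    then have "2 * nrm x \<le> \<bar>m\<bar> * nrm y" using py by (simp add: K_def field_simps)
    also have "\<bar>m\<bar> * nrm y = nrm ((x + m *\<^sub>R y) - x)" using y by (simp add: nrm_scaleR)
    also have "\<dots> \<le> f m + nrm x" unfolding f_def by (rule nrm_diff_le) (use x y in simp_all)
    finally have "f 0 \<le> f m" by (simp add: f_def)
    moreover have "f l \<le> f 0" using l(2)[of 0] K0 by simp
    ultimately show ?thesis by simp
  qed (use l in blast)
  then have "birkhoff_orth nrm (x + l *\<^sub>R y) y"
    unfolding birkhoff_orth_def f_def by (metis add.assoc scaleR_add_left)
  then show ?thesis by (rule that)
qed

text \<open>Gram-Schmidt with a Birkhoff foot in place of the projection. The span clause later lets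
  the pair serve as a coordinate basis of a plane.\<close>

lemma exists_orth_unit_pair:
  assumes V: "x \<in> V" "y \<in> V" and xy: "independent {x, y}" "x \<noteq> y"
  obtains u v where "u \<in> unit_sphere V nrm" "v \<in> unit_sphere V nrm" "birkhoff_orth nrm u v"
    "{x, y} \<subseteq> span {u, v}"
proof -
  have y0: "y \<noteq> 0" using xy dependent_zero by blast
  obtain l where l: "birkhoff_orth nrm (x + l *\<^sub>R y) y"
    using exists_birkhoff_foot V y0 by blast
  define z where "z = x + l *\<^sub>R y"
  have "z \<noteq> 0"
  proof
    assume "z = 0"
    then have "x = (- l) *\<^sub>R y" by (simp add: z_def eq_neg_iff_add_eq_0)
    then have "x \<in> span {y}" by (metis span_base span_scale singletonI)
    moreover have "{x, y} - {x} = {y}" using xy by auto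
    ultimately have "x \<in> span ({x, y} - {x})" by simp
    then show False using xy(1) unfolding dependent_def by blast
  qed
  moreover have "z \<in> V" by (simp add: z_def V)
  ultimately have p: "0 < nrm z" "0 < nrm y" using nrm_pos V y0 by auto
  define u where "u = (1 / nrm z) *\<^sub>R z"
  define v where "v = (1 / nrm y) *\<^sub>R y"
  have "birkhoff_orth nrm u v"
    unfolding u_def v_def using l \<open>z \<in> V\<close> V by (intro birkhoff_orth_scaleR) (auto simp: z_def)
  moreover have "u \<in> unit_sphere V nrm" "v \<in> unit_sphere V nrm"
    using p V \<open>z \<in> V\<close> by (auto simp: u_def v_def unit_sphere_def nrm_scaleR)
  moreover have "y = nrm y *\<^sub>R v" "x = nrm z *\<^sub>R u - (l * nrm y) *\<^sub>R v"
    using p by (auto simp: u_def v_def z_def)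
  then have "{x, y} \<subseteq> span {u, v}"
    by (metis empty_subsetI insertI1 insertI2 insert_subset span_base span_diff span_scale)
  ultimately show ?thesis by (intro that)
qed

section \<open>Evaluation of the constant\<close>

lemma orth_unit_norm_diff_pos:
  assumes "u \<in> unit_sphere V nrm" "v \<in> unit_sphere V nrm" "birkhoff_orth nrm u v"
  shows "0 < nrm (u - v)"
  using birkhoff_orth_le[of u v 1 "-1"] assms by (simp add: unit_sphere_def)

text \<open>For \<open>t = sqrt ((1 + \<mu>) / (1 - \<mu>))\<close> the vector \<open>t u - v/t\<close> is \<open>(u - v) + \<mu> (u + v)\<close> divided by
  \<open>sqrt (1 - \<mu>^2)\<close>; as the loss is quadratic in \<open>\<mu>\<close>, convexity of the norm removes it.\<close>

lemma orth_diff_sum_iff: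
  assumes u: "u \<in> V" and v: "v \<in> V"
  shows "birkhoff_orth nrm (u - v) (u + v) \<longleftrightarrow>
    (\<forall>t>0. nrm (u - v) \<le> nrm (t *\<^sub>R u - (1 / t) *\<^sub>R v))"
proof
  assume o: "birkhoff_orth nrm (u - v) (u + v)"
  show "\<forall>t>0. nrm (u - v) \<le> nrm (t *\<^sub>R u - (1 / t) *\<^sub>R v)"
  proof (intro allI impI)
    fix t :: real assume t: "t > 0"
    have "(a + b) *\<^sub>R u - (a - b) *\<^sub>R v = a *\<^sub>R (u - v) + b *\<^sub>R (u + v)" for a b
      by (simp add: algebra_simps)
    from this[of "(t + 1 / t) / 2" "(t - 1 / t) / 2"]
    have e: "t *\<^sub>R u - (1 / t) *\<^sub>R v = ((t + 1 / t) / 2) *\<^sub>R (u - v) + ((t - 1 / t) / 2) *\<^sub>R (u + v)"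
      by (simp add: field_simps)
    have "0 \<le> (t - 1)\<^sup>2 / t" using t by simp
    then have "1 \<le> (t + 1 / t) / 2" using t by (simp add: field_simps power2_eq_square)
    then have "1 * nrm (u - v) \<le> \<bar>(t + 1 / t) / 2\<bar> * nrm (u - v)"
      using nrm_nonneg[of "u - v"] u v by (intro mult_right_mono) auto
    also have "\<dots> \<le> nrm (t *\<^sub>R u - (1 / t) *\<^sub>R v)"
      unfolding e by (rule birkhoff_orth_le[OF _ _ o]) (use u v in simp_all)
    finally show "nrm (u - v) \<le> nrm (t *\<^sub>R u - (1 / t) *\<^sub>R v)" by simp
  qed
next
  assume H: "\<forall>t>0. nrm (u - v) \<le> nrm (t *\<^sub>R u - (1 / t) *\<^sub>R v)"
  define f where "f m = nrm ((u - v) + m *\<^sub>R (u + v))" for m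
  have f0: "0 \<le> f m" for m unfolding f_def using u v nrm_nonneg by simp
  have low: "(1 - m\<^sup>2) * f 0 \<le> f m" if m: "\<bar>m\<bar> < 1" for m
  proof -
    have p: "1 + m > 0" "1 - m > 0" using m by auto
    define t where "t = sqrt (1 + m) / sqrt (1 - m)"
    have t: "t > 0" using p by (simp add: t_def)
    define k where "k = sqrt (1 + m) * sqrt (1 - m)"
    have kt: "k * t = 1 + m" "k * (1 / t) = 1 - m"
      using p by (simp_all add: k_def t_def)
    have k0: "0 \<le> k" using p by (simp add: k_def)
    have k2: "k\<^sup>2 = 1 - m\<^sup>2"
      using p by (simp add: k_def power_mult_distrib) (simp add: power2_eq_square algebra_simps)
    then have "k\<^sup>2 \<le> 1\<^sup>2" by simp
    then have "k \<le> 1" by (rule power2_le_imp_le) simp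
    then have kk: "1 - m\<^sup>2 \<le> k" unfolding k2[symmetric]
      using k0 mult_left_le[of k k] by (simp add: power2_eq_square)
    have "(u - v) + m *\<^sub>R (u + v) = (1 + m) *\<^sub>R u - (1 - m) *\<^sub>R v"
      by (simp add: algebra_simps)
    also have "\<dots> = k *\<^sub>R (t *\<^sub>R u - (1 / t) *\<^sub>R v)"
      unfolding kt[symmetric] by (simp add: algebra_simps)
    finally have "f m = k * nrm (t *\<^sub>R u - (1 / t) *\<^sub>R v)"
      using u v k0 by (simp add: f_def nrm_scaleR del: scaleR_scaleR)
    also have "\<dots> \<ge> k * f 0" using H t k0 by (intro mult_left_mono) (auto simp: f_def)
    moreover have "(1 - m\<^sup>2) * f 0 \<le> k * f 0" using kk f0 by (rule mult_right_mono)
    ultimately show ?thesis by linarith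
  qed
  show "birkhoff_orth nrm (u - v) (u + v)"
    unfolding birkhoff_orth_def
  proof
    fix l :: real
    have "f 0 \<le> f l"
    proof (rule ccontr)
      assume "\<not> f 0 \<le> f l"
      define d where "d = f 0 - f l"
      have d: "0 < d" "d \<le> f 0" using \<open>\<not> f 0 \<le> f l\<close> f0[of l] by (auto simp: d_def)
      then have p0: "0 < f 0" by linarith
      \<comment> \<open>\<open>L\<close> dominates 1, \<open>\<bar>l\<bar>\<close> and
        \<open>l\<^sup>2\<close> at once. With \<open>e = d / (f 0 * L)\<close> the point
        \<open>e * l\<close> lies in the range of \<open>low\<close>; there convexity predicts a
        drop of \<open>e * d\<close>, while \<open>low\<close> allows only
        \<open>e\<^sup>2 * l\<^sup>2 * f 0\<close>, which is smaller.\<close>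
      define L where "L = 2 * l\<^sup>2 + 2"
      have L: "L > 1" "\<bar>l\<bar> < L" "l\<^sup>2 < L"
      proof -
        have "0 \<le> (\<bar>l\<bar> - 1)\<^sup>2" by simp
        then have "2 * \<bar>l\<bar> \<le> l\<^sup>2 + 1" by (simp add: power2_eq_square algebra_simps)
        then show "1 < L" "\<bar>l\<bar> < L" "l\<^sup>2 < L"
          using zero_le_power2[of l] abs_ge_zero[of l] unfolding L_def by - linarith+
      qed
      define e where "e = d / (f 0 * L)"
      have e0: "0 < e" using d p0 L by (simp add: e_def)
      have eL: "e * L \<le> 1" using d p0 L by (simp add: e_def)
      have "e * 1 < e * L" using e0 L by (intro mult_strict_left_mono) auto
      then have e1: "e < 1" using eL by simp
      have "e * \<bar>l\<bar> < e * L" using e0 L by (intro mult_strict_left_mono) auto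
      moreover have "\<bar>e * l\<bar> = e * \<bar>l\<bar>" using e0 by (simp add: abs_mult)
      ultimately have "\<bar>e * l\<bar> < 1" using eL by linarith
      from low[OF this] have "(1 - (e * l)\<^sup>2) * f 0 \<le> f (e * l)" .
      also have "f (e * l) \<le> (1 - e) * f 0 + e * f l"
      proof -
        have "(u - v) + (e * l) *\<^sub>R (u + v) = (1 - e) *\<^sub>R (u - v) + e *\<^sub>R ((u - v) + l *\<^sub>R (u + v))"
          by (simp add: algebra_simps)
        then have "f (e * l) \<le> nrm ((1 - e) *\<^sub>R (u - v)) + nrm (e *\<^sub>R ((u - v) + l *\<^sub>R (u + v)))"
          unfolding f_def using u v nrm_triangle by simp
        also have "\<dots> = \<bar>1 - e\<bar> * f 0 + \<bar>e\<bar> * f l"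
          unfolding f_def using u v by (subst (1 2) nrm_scaleR) auto
        finally show ?thesis using e0 e1 by simp
      qed
      finally have "e * d \<le> e * (e * l\<^sup>2 * f 0)"
        by (simp add: d_def power_mult_distrib power2_eq_square algebra_simps)
      then have "d \<le> e * l\<^sup>2 * f 0" using e0 by simp
      also have "\<dots> < e * L * f 0" using L e0 p0 by simp
      also have "\<dots> = d" using p0 L by (simp add: e_def)
      finally show False by simp
    qed
    then show "nrm (u - v) \<le> nrm (u - v + l *\<^sub>R (u + v))" by (simp add: f_def)
  qed
qed

text \<open>The quotient depends only on the directions of \<open>x\<close>, \<open>y\<close> and on
  \<open>t = nrm x / nrm y\<close>, so the supremum runs over \<open>R\<close>. The value 1 is
  attained at \<open>t = 1\<close>; hence the supremum is 1 exactly if no quotient exceeds 1, which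
  \<open>orth_diff_sum_iff\<close> translates into orthogonality.\<close>

lemma DR_B_eq_one_iff:
  assumes "dim_at_least_2 V"
  shows "DR_B V nrm = 1 \<longleftrightarrow>
    (\<forall>u\<in>unit_sphere V nrm. \<forall>v\<in>unit_sphere V nrm.
       birkhoff_orth nrm u v \<longrightarrow> birkhoff_orth nrm (u - v) (u + v))"
proof -
  let ?S = "unit_sphere V nrm"
  define R where "R = {nrm (u - v) / nrm (t *\<^sub>R u - (1 / t) *\<^sub>R v) | u v t.
    u \<in> ?S \<and> v \<in> ?S \<and> birkhoff_orth nrm u v \<and> 0 < t}"
  \<comment> \<open>One of the lower bounds \<open>t\<close> and \<open>1 / t - t\<close> is always
    at least 1/2. This crude value suffices to make every denominator nonzero and to bound
    \<open>R\<close> by 4.\<close>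
  have bpos: "1 / 2 \<le> nrm (t *\<^sub>R u - (1 / t) *\<^sub>R v)"
    if uv: "u \<in> ?S" "v \<in> ?S" "birkhoff_orth nrm u v" and t: "0 < t" for u v t
  proof -
    have V: "u \<in> V" "v \<in> V" "nrm u = 1" "nrm v = 1" using uv by (auto simp: unit_sphere_def)
    have 1: "t \<le> nrm (t *\<^sub>R u - (1 / t) *\<^sub>R v)"
      using birkhoff_orth_le[of u v t "- (1 / t)"] V uv t by simp
    have "nrm ((1 / t) *\<^sub>R v) \<le> nrm (t *\<^sub>R u - ((t *\<^sub>R u - (1 / t) *\<^sub>R v)))" by simp
    also have "\<dots> \<le> nrm (t *\<^sub>R u) + nrm (t *\<^sub>R u - (1 / t) *\<^sub>R v)"
      using V nrm_diff_le by (meson V_closed)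
    finally have 2: "1 / t - t \<le> nrm (t *\<^sub>R u - (1 / t) *\<^sub>R v)" using V t by (simp add: nrm_scaleR)
    show ?thesis
    proof (cases "t \<ge> 1 / 2")
      case False
      then have "2 \<le> 1 / t" using t by (simp add: field_simps)
      then show ?thesis using 2 False by linarith
    qed (use 1 in linarith)
  qed
  have DR: "DR_B V nrm = Sup R"
  proof -
    have "{DR_alpha nrm x y / DR_beta nrm x y | x y.
      x \<in> V - {0} \<and> y \<in> V - {0} \<and> birkhoff_orth nrm x y \<and> DR_beta nrm x y \<noteq> 0} = R" (is "?D = R")
    proof (intro equalityI subsetI)
      fix q assume "q \<in> ?D"
      then obtain x y where xy: "x \<in> V" "x \<noteq> 0" "y \<in> V" "y \<noteq> 0" "birkhoff_orth nrm x y"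
        and q: "q = DR_alpha nrm x y / DR_beta nrm x y" by auto
      have p: "0 < nrm x" "0 < nrm y" using nrm_pos xy by auto
      define u v t where "u = (1 / nrm x) *\<^sub>R x" "v = (1 / nrm y) *\<^sub>R y" "t = nrm x / nrm y"
      note defs = this
      have "u \<in> ?S" "v \<in> ?S" using xy p by (auto simp: defs unit_sphere_def nrm_scaleR)
      moreover have "birkhoff_orth nrm u v" unfolding defs using xy by (intro birkhoff_orth_scaleR)
      moreover have "0 < t" using p by (simp add: defs)
      moreover have "q = nrm (u - v) / nrm (t *\<^sub>R u - (1 / t) *\<^sub>R v)"
      proof -
        have "t *\<^sub>R u = x /\<^sub>R nrm y" "(1 / t) *\<^sub>R v = y /\<^sub>R nrm x" "u = x /\<^sub>R nrm x" "v = y /\<^sub>R nrm y"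
          using p by (simp_all add: defs divide_inverse)
        then show ?thesis unfolding q DR_alpha_def DR_beta_def by metis
      qed
      ultimately show "q \<in> R" unfolding R_def by blast
    next
      fix q assume "q \<in> R"
      then obtain u v t where uv: "u \<in> ?S" "v \<in> ?S" "birkhoff_orth nrm u v" and t: "0 < t"
        and q: "q = nrm (u - v) / nrm (t *\<^sub>R u - (1 / t) *\<^sub>R v)" unfolding R_def by blast
      have V: "u \<in> V" "v \<in> V" "nrm u = 1" "nrm v = 1" using uv by (auto simp: unit_sphere_def)
      have n: "nrm (t *\<^sub>R u) = t" using V t by (simp add: nrm_scaleR)
      have "u \<noteq> 0" "v \<noteq> 0" using V by auto
      then have "t *\<^sub>R u \<in> V - {0}" "v \<in> V - {0}" using V t by auto
      moreover have "birkhoff_orth nrm (t *\<^sub>R u) v"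
        using birkhoff_orth_scaleR[of u v t 1] V uv by simp
      moreover have be: "DR_beta nrm (t *\<^sub>R u) v = nrm (t *\<^sub>R u - (1 / t) *\<^sub>R v)"
        unfolding DR_beta_def n V by (simp add: divide_inverse)
      moreover have "DR_alpha nrm (t *\<^sub>R u) v = nrm (u - v)"
        unfolding DR_alpha_def n V using t by simp
      moreover have "DR_beta nrm (t *\<^sub>R u) v \<noteq> 0" using bpos[OF uv t] be by linarith
      moreover have "q = DR_alpha nrm (t *\<^sub>R u) v / DR_beta nrm (t *\<^sub>R u) v"
        by (simp only: q calculation)
      ultimately show "q \<in> ?D" by blast
    qed
    then show ?thesis unfolding DR_B_def by simp
  qed
  have bdd: "bdd_above R"
  proof (rule bdd_aboveI)
    fix q assume "q \<in> R"
    then obtain u v t where uv: "u \<in> ?S" "v \<in> ?S" "birkhoff_orth nrm u v" and t: "0 < t"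
      and q: "q = nrm (u - v) / nrm (t *\<^sub>R u - (1 / t) *\<^sub>R v)" unfolding R_def by blast
    have "nrm (u - v) \<le> 2" using uv nrm_diff_le[of u v] by (auto simp: unit_sphere_def)
    then have "q \<le> 2 / (1 / 2)"
      unfolding q using bpos[OF uv t] by (intro frac_le) auto
    then show "q \<le> 4" by simp
  qed
  have one: "1 \<in> R"
  proof -
    obtain u v where uv: "u \<in> ?S" "v \<in> ?S" "birkhoff_orth nrm u v"
      using exists_orth_unit_pair assms unfolding dim_at_least_2_def card_2_iff
      by (metis insert_subset)
    have "1 = nrm (u - v) / nrm (1 *\<^sub>R u - (1 / 1) *\<^sub>R v)" using orth_unit_norm_diff_pos[OF uv] by simp
    then show ?thesis unfolding R_def using uv zero_less_one by blast
  qed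
  have "Sup R = 1 \<longleftrightarrow> (\<forall>q\<in>R. q \<le> 1)"
    using one bdd by (metis cSup_eq_maximum cSup_upper)
  also have "\<dots> \<longleftrightarrow> (\<forall>u\<in>?S. \<forall>v\<in>?S. birkhoff_orth nrm u v \<longrightarrow>
      (\<forall>t>0. nrm (u - v) / nrm (t *\<^sub>R u - (1 / t) *\<^sub>R v) \<le> 1))"
    unfolding R_def by blast
  also have "\<dots> \<longleftrightarrow> (\<forall>u\<in>?S. \<forall>v\<in>?S. birkhoff_orth nrm u v \<longrightarrow>
      (\<forall>t>0. nrm (u - v) \<le> nrm (t *\<^sub>R u - (1 / t) *\<^sub>R v)))"
  proof (intro ball_cong refl imp_cong all_cong1)
    fix u v and t :: real
    assume "u \<in> ?S" "v \<in> ?S" "birkhoff_orth nrm u v" "0 < t"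
    from bpos[OF this] have "0 < nrm (t *\<^sub>R u - (1 / t) *\<^sub>R v)" by linarith
    then show "nrm (u - v) / nrm (t *\<^sub>R u - (1 / t) *\<^sub>R v) \<le> 1 \<longleftrightarrow>
      nrm (u - v) \<le> nrm (t *\<^sub>R u - (1 / t) *\<^sub>R v)" by (simp add: divide_le_eq)
  qed
  also have "\<dots> \<longleftrightarrow> (\<forall>u\<in>?S. \<forall>v\<in>?S. birkhoff_orth nrm u v \<longrightarrow> birkhoff_orth nrm (u - v) (u + v))"
    by (intro ball_cong refl imp_cong orth_diff_sum_iff[symmetric]) (auto simp: unit_sphere_def)
  finally show ?thesis unfolding DR .
qed

text \<open>Birkhoff orthogonality forces \<open>ip u v = 0\<close>, and then
  \<open>ip (u - v) (u + v)\<close> is the difference of two equal squares.\<close>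

lemma inner_product_orth_diff_sum:
  assumes "norm_induced_by_inner_product V nrm"
    and u: "u \<in> unit_sphere V nrm" and v: "v \<in> unit_sphere V nrm" and o: "birkhoff_orth nrm u v"
  shows "birkhoff_orth nrm (u - v) (u + v)"
proof -
  obtain ip where ip: "inner_product_on V ip" and n: "\<And>x. x \<in> V \<Longrightarrow> nrm x = sqrt (ip x x)"
    using assms(1) unfolding norm_induced_by_inner_product_def by blast
  note ip1 = ip[unfolded inner_product_on_def, THEN conjunct1]
    and ip2 = ip[unfolded inner_product_on_def, THEN conjunct2, THEN conjunct1]
    and ip3 = ip[unfolded inner_product_on_def, THEN conjunct2, THEN conjunct2, THEN conjunct1]
  have com: "ip x y = ip y x" if "x \<in> V" "y \<in> V" for x y using ip1 that by blast
  have add: "ip (x + y) z = ip x z + ip y z" if "x \<in> V" "y \<in> V" "z \<in> V" for x y z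
    using ip2 that by blast
  have sc: "ip (c *\<^sub>R x) y = c * ip x y" if "x \<in> V" "y \<in> V" for x y c using ip3 that by blast
  have add': "ip z (x + y) = ip z x + ip z y" if "x \<in> V" "y \<in> V" "z \<in> V" for x y z
    using that add[of x y z] by (simp only: com[of z] V_closed)
  have sc': "ip y (c *\<^sub>R x) = c * ip y x" if "x \<in> V" "y \<in> V" for x y c
    using that sc[of x y c] by (simp only: com[of y] V_closed)
  have sq: "ip (x + l *\<^sub>R y) (x + l *\<^sub>R y) = ip x x + 2 * l * ip x y + l\<^sup>2 * ip y y"
    if "x \<in> V" "y \<in> V" for x y l
    using that com[of y x] by (simp add: add add' sc sc' power2_eq_square distrib_left)
  have uv: "u \<in> V" "v \<in> V" "ip u u = 1" "ip v v = 1"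
    using u v n[of u] n[of v] by (auto simp: unit_sphere_def)
  \<comment> \<open>The multiplier is that of the Euclidean projection, where the squared norm drops
    by exactly \<open>(ip u v)\<^sup>2\<close>.\<close>
  have "nrm u \<le> nrm (u + (- ip u v) *\<^sub>R v)" using o unfolding birkhoff_orth_def by blast
  then have "ip u u \<le> ip (u + (- ip u v) *\<^sub>R v) (u + (- ip u v) *\<^sub>R v)"
    using uv(1,2) by (simp only: n V_closed real_sqrt_le_iff)
  then have "(ip u v)\<^sup>2 \<le> 0" using uv sq[of u v "- ip u v"] by (simp add: power2_eq_square)
  then have "ip u v = 0" by simp
  moreover have "ip (u - v) w = ip u w - ip v w" if "w \<in> V" for w
    using that uv add[of u "- v" w] sc[of v w "-1"] by simp
  ultimately have z: "ip (u - v) (u + v) = 0" using uv com[of u v] by (simp add: add')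
  have uvV: "u - v \<in> V" "u + v \<in> V" using uv by auto
  show ?thesis
    unfolding birkhoff_orth_def
  proof
    fix l
    have "0 \<le> ip (u + v) (u + v)"
      using nrm_nonneg[of "u + v"] n[of "u + v"] uv by simp
    then have "ip (u - v) (u - v) \<le> ip (u - v + l *\<^sub>R (u + v)) (u - v + l *\<^sub>R (u + v))"
      unfolding sq[OF uvV] z by simp
    then show "nrm (u - v) \<le> nrm (u - v + l *\<^sub>R (u + v))"
      using uvV by (simp only: n V_closed real_sqrt_le_iff)
  qed
qed

end

subsection \<open>Smooth Radon planes\<close>

definition wedge :: "complex \<Rightarrow> complex \<Rightarrow> real" where
  "wedge x y = Re x * Im y - Im x * Re y"

lemma wedge_simps [simp]:
  "wedge x x = 0"
  "wedge (x + y) z = wedge x z + wedge y z" "wedge z (x + y) = wedge z x + wedge z y"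
  "wedge (x - y) z = wedge x z - wedge y z" "wedge z (x - y) = wedge z x - wedge z y"
  "wedge (- x) z = - wedge x z" "wedge z (- x) = - wedge z x"
  "wedge (c *\<^sub>R x) z = c * wedge x z" "wedge z (c *\<^sub>R x) = c * wedge z x"
  "wedge 0 z = 0" "wedge z 0 = 0"
  by (simp_all add: wedge_def algebra_simps)

lemma wedge_swap: "wedge y x = - wedge x y"
  by (simp add: wedge_def)

lemma wedge_cramer: "wedge u v *\<^sub>R x = wedge x v *\<^sub>R u + wedge u x *\<^sub>R v"
  by (simp add: wedge_def complex_eq_iff algebra_simps)

lemma wedge_plucker:
  "wedge u u' * wedge v v' = wedge u v * wedge u' v' - wedge u' v * wedge u v'"
  by (simp add: wedge_def algebra_simps)

lemma wedge_cis: "wedge (cis a) (cis b) = sin (b - a)"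
  by (simp add: wedge_def sin_diff algebra_simps)

lemma continuous_on_wedge [continuous_intros]:
  "continuous_on S f \<Longrightarrow> continuous_on S g \<Longrightarrow> continuous_on S (\<lambda>x. wedge (f x) (g x))"
  unfolding wedge_def by (intro continuous_intros)

text \<open>A smooth Radon plane in coordinates along an orthogonal pair of unit vectors. The
  complex plane supplies a topology and the polar form \<open>cis\<close>. The pair spans area 1,
  which fixes the scale of the area form.\<close>

locale radon_norm = normed_space_on "UNIV :: complex set" N for N +
  assumes orth_sym: "birkhoff_orth N x y \<Longrightarrow> birkhoff_orth N y x"
    and smooth: "smooth_space UNIV N"
    and N_one: "N 1 = 1" and N_ii: "N \<i> = 1" and orth_one_ii: "birkhoff_orth N 1 \<i>"
begin

section \<open>Orthogonality and supporting functionals\<close>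

abbreviation orth where "orth \<equiv> birkhoff_orth N"

lemmas N_scaleR = nrm_scaleR[OF UNIV_I] and N_pos = nrm_pos[OF UNIV_I]
  and N_nonneg = nrm_nonneg[OF UNIV_I] and N_minus = nrm_minus[OF UNIV_I]
  and N_triangle = nrm_triangle[OF UNIV_I UNIV_I]
  and orth_scaleR = birkhoff_orth_scaleR[OF UNIV_I UNIV_I]
  and orth_le = birkhoff_orth_le[OF UNIV_I UNIV_I]

text \<open>By Cramer's rule \<open>wedge x y\<close> is the \<open>u\<close>-coordinate of
  \<open>wedge u y *\<^sub>R x\<close> in terms of \<open>u\<close> and \<open>y\<close>. Thus, for
  nonzero \<open>u\<close>, the functional \<open>wedge _ y\<close> attains its norm in the
  direction of \<open>u\<close>.\<close>

lemma wedge_le_of_orth: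
  assumes "orth u y"
  shows "\<bar>wedge x y\<bar> * N u \<le> \<bar>wedge u y\<bar> * N x"
proof -
  have "\<bar>wedge x y\<bar> * N u \<le> N (wedge u y *\<^sub>R x)"
    unfolding wedge_cramer[of u y x] by (rule orth_le[OF assms])
  then show ?thesis by (simp only: N_scaleR)
qed

lemma wedge_ne_zero_of_orth:
  assumes "orth u y" "u \<noteq> 0" "y \<noteq> 0"
  shows "wedge u y \<noteq> 0"
proof
  assume "wedge u y = 0"
  \<comment> \<open>The Euclidean quarter turn of \<open>y\<close> is a test vector on which
    \<open>wedge _ y\<close> cannot vanish.\<close>
  then have "\<bar>wedge (\<i> * y) y\<bar> * N u \<le> 0" using wedge_le_of_orth[OF assms(1), of "\<i> * y"] by simp
  moreover have "0 < N u" using N_pos assms by blast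
  ultimately have "wedge (\<i> * y) y = 0" by (simp add: mult_le_0_iff)
  moreover have "wedge (\<i> * y) y = - (Re y * Re y + Im y * Im y)" by (simp add: wedge_def)
  ultimately have "Re y * Re y + Im y * Im y = 0" by linarith
  then have "Re y = 0 \<and> Im y = 0" by (simp only: sum_squares_eq_zero_iff)
  then show False using assms(3) by (simp add: complex_eq_iff)
qed

text \<open>The bridge from orthogonality to smoothness: a direction to which \<open>u\<close> is
  orthogonal spans the kernel of a supporting functional at \<open>u\<close>.\<close>

lemma supporting_functional_wedge:
  assumes "orth u y" "N u = 1" "y \<noteq> 0"
  shows "supporting_functional UNIV N u (\<lambda>x. wedge x y / wedge u y)"
proof -
  have "u \<noteq> 0" using assms by auto
  then have ne: "wedge u y \<noteq> 0" using assms wedge_ne_zero_of_orth by blast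
  have "\<bar>wedge x y / wedge u y\<bar> \<le> N x" for x
    using wedge_le_of_orth[OF assms(1), of x] assms(2) ne by (simp add: field_simps)
  then show ?thesis
    using ne by (simp add: supporting_functional_def add_divide_distrib)
qed

lemma supporting_functional_unique:
  assumes "supporting_functional UNIV N u f" "supporting_functional UNIV N u g" "N u = 1"
  shows "f x = g x"
  using smooth assms unfolding smooth_space_def unit_sphere_def by blast

text \<open>The vector \<open>u\<close> may have any norm, so that \<open>J\<close> can be applied
  to sums such as \<open>u + J u\<close> before they are normalized.\<close>

definition dual_unit :: "complex \<Rightarrow> complex \<Rightarrow> bool" where
  "dual_unit u y \<longleftrightarrow> N y = 1 \<and> orth u y \<and> 0 < wedge u y"

text \<open>Two candidates are kernels of supporting functionals at the same normalized point.
  Smoothness makes them parallel, and equal norm and orientation make them equal.\<close>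

lemma dual_unit_unique:
  assumes "dual_unit u y" "dual_unit u z" "u \<noteq> 0"
  shows "y = z"
proof -
  note y = assms(1)[unfolded dual_unit_def] and z = assms(2)[unfolded dual_unit_def]
  have p: "0 < N u" using N_pos assms by blast
  define w where "w = (1 / N u) *\<^sub>R u"
  have w: "N w = 1" "orth w y" "orth w z"
    using p y z orth_scaleR[of u y "1 / N u" 1] orth_scaleR[of u z "1 / N u" 1]
    by (auto simp: w_def N_scaleR)
  have ne: "y \<noteq> 0" "z \<noteq> 0" using y z by auto
  have "wedge z y / wedge w y = wedge z z / wedge w z"
    by (rule supporting_functional_unique[of w]) (use w ne supporting_functional_wedge in auto)
  moreover have "0 < wedge w y" using p y by (simp add: w_def)
  ultimately have "wedge z y = 0" by simp
  then have c: "wedge u y *\<^sub>R z = wedge u z *\<^sub>R y" using wedge_cramer[of u y z] by simp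
  then have "N (wedge u y *\<^sub>R z) = N (wedge u z *\<^sub>R y)" by simp
  then have "wedge u y = wedge u z" using y z by (simp add: N_scaleR)
  then have "wedge u y *\<^sub>R z = wedge u y *\<^sub>R y" using c by metis
  moreover have "wedge u y \<noteq> 0" using y by simp
  ultimately show ?thesis by (metis scaleR_left_imp_eq)
qed

text \<open>A foot on the direction of \<open>u\<close> yields a vector orthogonal to
  \<open>u\<close>; symmetry turns this into the required order. Starting from
  \<open>\<i> * u\<close> makes the orientation positive.\<close>

lemma dual_unit_exists:
  assumes "u \<noteq> 0"
  shows "\<exists>y. dual_unit u y"
proof -
  obtain l where l: "orth (\<i> * u + l *\<^sub>R u) u"
    using exists_birkhoff_foot[of "\<i> * u" u] assms by auto
  define z where "z = \<i> * u + l *\<^sub>R u"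
  have "orth u z" using l orth_sym by (simp add: z_def)
  have "wedge u z = Re u * Re u + Im u * Im u" by (simp add: z_def) (simp add: wedge_def)
  then have wz: "0 < wedge u z" using assms by (simp only: sum_squares_gt_zero_iff) (simp add: complex_eq_iff)
  then have "z \<noteq> 0" by auto
  then have p: "0 < N z" using N_pos by blast
  then have "dual_unit u ((1 / N z) *\<^sub>R z)"
    using orth_scaleR[of u z 1 "1 / N z"] \<open>orth u z\<close> wz by (simp add: dual_unit_def N_scaleR)
  then show ?thesis by blast
qed

section \<open>The quarter turn of the norm\<close>

definition J :: "complex \<Rightarrow> complex" where
  "J u = (THE y. dual_unit u y)"

lemma J_eq: "u \<noteq> 0 \<Longrightarrow> dual_unit u y \<Longrightarrow> J u = y"
  unfolding J_def using dual_unit_unique by blast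

lemma dual_unit_J: "u \<noteq> 0 \<Longrightarrow> dual_unit u (J u)"
  using dual_unit_exists J_eq by metis

lemma
  assumes "u \<noteq> 0"
  shows N_J: "N (J u) = 1" and orth_J: "orth u (J u)" and wedge_J_pos: "0 < wedge u (J u)"
  using dual_unit_J[OF assms] by (auto simp: dual_unit_def)

lemma J_minus:
  assumes "u \<noteq> 0"
  shows "J (- u) = - J u"
  using orth_scaleR[OF orth_J[OF assms], of "-1" "-1"] N_J[OF assms] wedge_J_pos[OF assms] assms
  by (intro J_eq) (auto simp: dual_unit_def N_minus)

lemma J_scaleR:
  assumes "u \<noteq> 0" "0 < c"
  shows "J (c *\<^sub>R u) = J u"
  using orth_scaleR[OF orth_J[OF assms(1)], of c 1] N_J[OF assms(1)] wedge_J_pos[OF assms(1)] assms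
  by (intro J_eq) (auto simp: dual_unit_def)

text \<open>Symmetry makes \<open>J u\<close> orthogonal to \<open>u\<close>, and the orientation
  selects the sign.\<close>

lemma J_J:
  assumes "N u = 1"
  shows "J (J u) = - u"
proof -
  have u: "u \<noteq> 0" using assms by auto
  have "orth (J u) (- u)"
    using orth_scaleR[OF orth_sym[OF orth_J[OF u]], of 1 "-1"] by simp
  moreover have "J u \<noteq> 0" using N_J[OF u] by auto
  ultimately show ?thesis
    using wedge_J_pos[OF u] wedge_swap[of u "J u"] assms
    by (intro J_eq) (auto simp: dual_unit_def N_minus)
qed

lemma J_one: "J 1 = \<i>"
  using orth_one_ii N_ii by (intro J_eq) (auto simp: dual_unit_def wedge_def)

section \<open>The unit circle, its topology and its parametrization by angle\<close>

lemma abs_Re_le_N: "\<bar>Re z\<bar> \<le> N z" and abs_Im_le_N: "\<bar>Im z\<bar> \<le> N z"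
proof -
  have e: "Re z *\<^sub>R 1 + Im z *\<^sub>R \<i> = z" "Im z *\<^sub>R \<i> + Re z *\<^sub>R 1 = z"
    by (simp_all add: complex_eq_iff)
  show "\<bar>Re z\<bar> \<le> N z"
    using orth_le[OF orth_one_ii, of "Re z" "Im z"] unfolding e by (simp add: N_one)
  show "\<bar>Im z\<bar> \<le> N z"
    using orth_le[OF orth_sym[OF orth_one_ii], of "Im z" "Re z"] unfolding e by (simp add: N_ii)
qed

lemma N_le_cmod: "N z \<le> 2 * cmod z"
proof -
  have "N (Re z *\<^sub>R 1 + Im z *\<^sub>R \<i>) \<le> \<bar>Re z\<bar> + \<bar>Im z\<bar>"
    using N_triangle[of "Re z *\<^sub>R 1" "Im z *\<^sub>R \<i>"] unfolding N_scaleR N_one N_ii by simp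
  moreover have "Re z *\<^sub>R 1 + Im z *\<^sub>R \<i> = z" by (simp add: complex_eq_iff)
  ultimately show ?thesis using abs_Re_le_cmod[of z] abs_Im_le_cmod[of z] by simp
qed

lemma continuous_on_N: "continuous_on UNIV N"
proof (rule lipschitz_on_continuous_on, rule lipschitz_onI)
  fix x y
  show "dist (N x) (N y) \<le> 2 * dist x y"
    using nrm_abs_diff_le[of x y] N_le_cmod[of "x - y"] by (simp add: dist_norm)
qed simp

lemma continuous_on_N_comp [continuous_intros]:
  "continuous_on S f \<Longrightarrow> continuous_on S (\<lambda>x. N (f x))"
  using continuous_on_compose2[OF continuous_on_N] by blast

lemma compact_N_sphere: "compact {y. N y = 1}"
proof -
  have "bounded {y. N y = 1}"
  proof (rule boundedI)
    fix y assume "y \<in> {y. N y = 1}"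
    then show "norm y \<le> 2"
      using cmod_le[of y] abs_Re_le_N[of y] abs_Im_le_N[of y] by simp
  qed
  moreover have "closed {y. N y = 1}" by (intro closed_Collect_eq continuous_intros)
  ultimately show ?thesis by (simp add: compact_eq_bounded_closed)
qed

text \<open>The parameter is the Euclidean angle, not area; the change of parameter shows up later
  as the factor \<open>1 / (N (cis s))\<^sup>2\<close>.\<close>

definition U :: "real \<Rightarrow> complex" where
  "U t = (1 / N (cis t)) *\<^sub>R cis t"

definition W :: "real \<Rightarrow> complex" where
  "W t = J (U t)"

lemma N_cis_pos: "0 < N (cis t)"
  by (intro N_pos) simp

lemma N_U: "N (U t) = 1"
  using N_cis_pos[of t] by (simp add: U_def N_scaleR)

lemma U_ne_zero: "U t \<noteq> 0"
  using N_U[of t] by auto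

lemma N_W: "N (W t) = 1"
  by (simp add: W_def N_J U_ne_zero)

lemma U_zero: "U 0 = 1" and W_zero: "W 0 = \<i>"
  by (simp_all add: W_def U_def N_one J_one)

lemma U_add_pi: "U (t + pi) = - U t"
  by (simp add: U_def N_minus flip: minus_cis)

lemma W_add_pi: "W (t + pi) = - W t"
  by (simp add: W_def U_add_pi J_minus U_ne_zero)

lemma obtain_U:
  assumes "N u = 1"
  obtains t where "- pi \<le> t" "t \<le> pi" "u = U t"
proof -
  have p: "0 < cmod u" using assms by auto
  have e: "u = cmod u *\<^sub>R cis (Arg u)"
    using rcis_cmod_Arg[of u] by (simp add: rcis_def scaleR_conv_of_real)
  then have "N u = cmod u * N (cis (Arg u))" by (metis N_scaleR abs_norm_cancel)
  then have "1 / N (cis (Arg u)) = cmod u" using assms p by (metis nonzero_eq_divide_eq less_irrefl mult_zero_right N_cis_pos)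
  then have "u = U (Arg u)" using e by (simp add: U_def)
  then show ?thesis using that[of "Arg u"] Arg_bounded[of u] by auto
qed

lemma continuous_on_U [continuous_intros]: "continuous_on S U"
proof -
  have "continuous_on S (\<lambda>t. (1 / N (cis t)) *\<^sub>R cis t)"
    using N_cis_pos by (intro continuous_intros) (metis less_irrefl)
  then show ?thesis by (simp add: U_def[abs_def])
qed

lemma continuous_on_U_comp [continuous_intros]:
  "continuous_on S f \<Longrightarrow> continuous_on S (\<lambda>x. U (f x))"
  using continuous_on_compose2[OF continuous_on_U[of UNIV]] by blast

text \<open>Smoothness makes the graph of \<^term>\<open>W\<close> the closed set below; its values lie in a compact set.\<close>

lemma continuous_on_W [continuous_intros]: "continuous_on S W"
proof -
  have "range (\<lambda>t. (t, W t)) =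
    {p. N (snd p) = 1 \<and> 0 \<le> wedge (U (fst p)) (snd p) \<and> (\<forall>l. 1 \<le> N (U (fst p) + l *\<^sub>R snd p))}"
    (is "_ = ?G")
  proof (intro equalityI subsetI)
    fix p assume "p \<in> range (\<lambda>t. (t, W t))"
    then obtain t where p: "p = (t, W t)" by blast
    have "orth (U t) (W t)" unfolding W_def using orth_J U_ne_zero by blast
    then show "p \<in> ?G"
      using wedge_J_pos[OF U_ne_zero[of t]] N_W[of t]
      by (simp add: p N_U birkhoff_orth_def W_def less_imp_le)
  next
    fix p assume p: "p \<in> ?G"
    then have o: "orth (U (fst p)) (snd p)" by (simp add: birkhoff_orth_def N_U)
    \<comment> \<open>A closed set can only demand \<open>0 \<le> wedge\<close>; orthogonality of
      nonzero vectors restores the strict sign.\<close>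
    have "snd p \<noteq> 0" using p by auto
    then have "wedge (U (fst p)) (snd p) \<noteq> 0" using o wedge_ne_zero_of_orth U_ne_zero by blast
    then have "W (fst p) = snd p"
      unfolding W_def using o p by (intro J_eq U_ne_zero) (auto simp: dual_unit_def)
    then show "p \<in> range (\<lambda>t. (t, W t))" by (metis prod.collapse rangeI)
  qed
  moreover have "closed ?G"
    by (intro closed_Collect_conj closed_Collect_all closed_Collect_eq closed_Collect_le continuous_intros)
  ultimately have "closed (range (\<lambda>t. (t, W t)))" by simp
  then have "continuous_on UNIV W"
    using continuous_from_closed_graph[OF compact_N_sphere, of W UNIV] N_W by auto
  then show ?thesis using continuous_on_subset by blast
qed

lemma tendsto_U: "(U \<longlongrightarrow> U s) (at s)" and tendsto_W: "(W \<longlongrightarrow> W s) (at s)"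
  using continuous_on_U[of UNIV] continuous_on_W[of UNIV]
  by (simp_all add: continuous_on_def)

section \<open>Areas of increments along the unit circle\<close>

lemma tendsto_wedge:
  "(f \<longlongrightarrow> a) F \<Longrightarrow> (g \<longlongrightarrow> b) F \<Longrightarrow> ((\<lambda>x. wedge (f x) (g x)) \<longlongrightarrow> wedge a b) F"
  unfolding wedge_def by (intro tendsto_intros)

text \<open>The radii enter \<open>wedge (U s) (U t)\<close> only as scalar factors of
  \<open>sin (t - s)\<close>, so continuity of \<open>N\<close> yields this derivative.\<close>

lemma wedge_U_quotient:
  "((\<lambda>t. wedge (U s) (U t) / (t - s)) \<longlongrightarrow> 1 / (N (cis s))\<^sup>2) (at s)"
proof -
  have "((\<lambda>t. sin (t - s)) has_real_derivative 1) (at s)"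
    by (auto intro!: derivative_eq_intros)
  then have "((\<lambda>t. sin (t - s) / (t - s)) \<longlongrightarrow> 1) (at s)"
    by (simp add: has_field_derivative_iff)
  moreover have "((\<lambda>t. N (cis t)) \<longlongrightarrow> N (cis s)) (at s)"
  proof -
    have "continuous_on UNIV (\<lambda>t. N (cis t))" by (intro continuous_intros)
    then show ?thesis by (simp add: continuous_on_def)
  qed
  ultimately have "((\<lambda>t. sin (t - s) / (t - s) * (1 / (N (cis s) * N (cis t)))) \<longlongrightarrow>
      1 * (1 / (N (cis s) * N (cis s)))) (at s)"
    using N_cis_pos[of s] by (intro tendsto_intros) auto
  moreover have "wedge (U s) (U t) / (t - s) = sin (t - s) / (t - s) * (1 / (N (cis s) * N (cis t)))" for t
    by (simp add: U_def wedge_cis ac_simps)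
  ultimately show ?thesis by (simp add: power2_eq_square)
qed

text \<open>On the unit circle \<open>wedge _ (W s)\<close> peaks at \<open>U s\<close>, and by
  symmetry of orthogonality \<open>wedge (U s) _\<close> peaks in modulus at
  \<open>W s\<close>.\<close>

lemma wedge_U_W_le:
  "\<bar>wedge (U t) (W s)\<bar> \<le> wedge (U s) (W s)" "\<bar>wedge (U s) (W t)\<bar> \<le> wedge (U s) (W s)"
proof -
  have o: "orth (U s) (W s)" and p: "0 < wedge (U s) (W s)"
    unfolding W_def using orth_J wedge_J_pos U_ne_zero by blast+
  show "\<bar>wedge (U t) (W s)\<bar> \<le> wedge (U s) (W s)"
    using wedge_le_of_orth[OF o, of "U t"] p by (simp add: N_U)
  show "\<bar>wedge (U s) (W t)\<bar> \<le> wedge (U s) (W s)"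
    using wedge_le_of_orth[OF orth_sym[OF o], of "W t"] p
      wedge_swap[of "U s" "W s"] wedge_swap[of "U s" "W t"] by (simp add: N_W)
qed

lemma eventually_wedge_U_W_pos:
  "eventually (\<lambda>t. 0 < wedge (U t) (W s) \<and> 0 < wedge (U s) (W t)) (at s)"
proof -
  have p: "0 < wedge (U s) (W s)" unfolding W_def using wedge_J_pos U_ne_zero by blast
  have "((\<lambda>t. wedge (U t) (W s)) \<longlongrightarrow> wedge (U s) (W s)) (at s)"
    "((\<lambda>t. wedge (U s) (W t)) \<longlongrightarrow> wedge (U s) (W s)) (at s)"
    by (intro tendsto_wedge tendsto_U tendsto_W tendsto_const)+
  then show ?thesis using p by (intro eventually_conj order_tendstoD)
qed

text \<open>The common error term of the later estimates: the first factor converges and the second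
  tends to 0 by continuity of \<open>W\<close>.\<close>

lemma wedge_area_quotient:
  "((\<lambda>t. \<bar>wedge (U s) (U t) / (t - s)\<bar> * \<bar>wedge (W s) (W t)\<bar>) \<longlongrightarrow> 0) (at s)"
proof -
  have "((\<lambda>t. wedge (W s) (W t)) \<longlongrightarrow> wedge (W s) (W s)) (at s)"
    by (intro tendsto_wedge tendsto_W tendsto_const)
  then have "((\<lambda>t. \<bar>wedge (U s) (U t) / (t - s)\<bar> * \<bar>wedge (W s) (W t)\<bar>) \<longlongrightarrow>
      \<bar>1 / (N (cis s))\<^sup>2\<bar> * \<bar>wedge (W s) (W s)\<bar>) (at s)"
    by (intro tendsto_intros wedge_U_quotient)
  then show ?thesis by simp
qed

text \<open>The Pluecker relation bounds the variation of \<open>wedge U W\<close> by a product of two increments.\<close>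

lemma wedge_U_W: "wedge (U t) (W t) = 1"
proof -
  define g where "g t = wedge (U t) (W t)" for t
  have gp: "0 < g t" for t unfolding g_def W_def using wedge_J_pos U_ne_zero by blast
  have "(g has_real_derivative 0) (at s)" for s
  proof -
    have lim: "((\<lambda>t. (\<bar>wedge (U s) (U t) / (t - s)\<bar> * \<bar>wedge (W s) (W t)\<bar>) * (2 / g s)) \<longlongrightarrow> 0) (at s)"
      using tendsto_mult_left_zero[OF wedge_area_quotient] by blast
    have "(g \<longlongrightarrow> g s) (at s)"
      unfolding g_def by (intro tendsto_wedge tendsto_U tendsto_W)
    then have "eventually (\<lambda>t. g s / 2 < g t) (at s)"
      using gp[of s] by (intro order_tendstoD) auto
    then have "eventually (\<lambda>t. norm ((g t - g s) / (t - s)) \<le>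
        (\<bar>wedge (U s) (U t) / (t - s)\<bar> * \<bar>wedge (W s) (W t)\<bar>) * (2 / g s)) (at s)"
      using eventually_wedge_U_W_pos[of s]
    proof eventually_elim
      case (elim t)
      \<comment> \<open>Both mixed areas are at most \<open>g s\<close> and at most
        \<open>g t\<close>, so their product is at most \<open>m * m\<close>. Since
        \<open>g s * g t = m * (m + \<bar>g t - g s\<bar>)\<close>, the Pluecker relation isolates
        the increment of \<open>g\<close>.\<close>
      define m where "m = min (g s) (g t)"
      have m: "g s / 2 \<le> m" "0 < m" using elim(1) gp[of s] gp[of t] by (auto simp: m_def)
      have "wedge (U t) (W s) \<le> m" "wedge (U s) (W t) \<le> m"
        using wedge_U_W_le[of t s] wedge_U_W_le[of s t] by (auto simp: m_def g_def)
      then have "wedge (U t) (W s) * wedge (U s) (W t) \<le> m * m"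
        using elim(2) m by (intro mult_mono) auto
      moreover have "g s * g t = m * (m + \<bar>g t - g s\<bar>)" by (auto simp: m_def min_def)
      ultimately have "m * \<bar>g t - g s\<bar> \<le> wedge (U s) (U t) * wedge (W s) (W t)"
        using wedge_plucker[of "U s" "U t" "W s" "W t"] by (simp add: g_def algebra_simps)
      also have "\<dots> \<le> \<bar>wedge (U s) (U t)\<bar> * \<bar>wedge (W s) (W t)\<bar>"
        by (simp flip: abs_mult)
      finally have "g s / 2 * \<bar>g t - g s\<bar> \<le> \<bar>wedge (U s) (U t)\<bar> * \<bar>wedge (W s) (W t)\<bar>"
        using m mult_right_mono[of "g s / 2" m "\<bar>g t - g s\<bar>"] by linarith
      then have "\<bar>g t - g s\<bar> \<le> \<bar>wedge (U s) (U t)\<bar> * \<bar>wedge (W s) (W t)\<bar> * (2 / g s)"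
        using gp[of s] by (simp add: field_simps)
      then have "\<bar>g t - g s\<bar> / \<bar>t - s\<bar> \<le> (\<bar>wedge (U s) (U t)\<bar> * \<bar>wedge (W s) (W t)\<bar> * (2 / g s)) / \<bar>t - s\<bar>"
        by (intro divide_right_mono) auto
      then show ?case by (simp add: abs_divide ac_simps)
    qed
    then have "((\<lambda>t. (g t - g s) / (t - s)) \<longlongrightarrow> 0) (at s)"
      using lim by (rule Lim_null_comparison)
    then show ?thesis by (simp add: has_field_derivative_iff)
  qed
  then have "g t = g 0" using DERIV_isconst_all by blast
  then show ?thesis by (simp add: g_def U_zero W_zero) (simp add: wedge_def)
qed

section \<open>Self-duality of the norm and strict convexity\<close>

lemma wedge_J:
  assumes "u \<noteq> 0"
  shows "wedge u (J u) = N u"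
proof -
  have p: "0 < N u" using N_pos assms by blast
  then have "N ((1 / N u) *\<^sub>R u) = 1" by (simp add: N_scaleR)
  then obtain t where t: "(1 / N u) *\<^sub>R u = U t" using obtain_U by metis
  then have "J u = W t" unfolding W_def using J_scaleR[of u "1 / N u"] assms p by simp
  then have "wedge ((1 / N u) *\<^sub>R u) (J u) = 1" using wedge_U_W t by simp
  then show ?thesis using p by simp
qed

lemma dual_unit_normalize:
  assumes "orth x y" "0 < wedge x y"
  shows "J x = (1 / N y) *\<^sub>R y" "wedge x y = N x * N y"
proof -
  have x: "x \<noteq> 0" "y \<noteq> 0" using assms by auto
  then have p: "0 < N y" using N_pos by blast
  show e: "J x = (1 / N y) *\<^sub>R y"
    using x p assms orth_scaleR[OF assms(1), of 1 "1 / N y"]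
    by (intro J_eq) (auto simp: dual_unit_def N_scaleR)
  show "wedge x y = N x * N y" using wedge_J[OF x(1)] p unfolding e by (simp add: field_simps)
qed

text \<open>The norm is its own dual under the area form: among unit vectors
  \<open>wedge _ y\<close> peaks in modulus at \<open>J y\<close>, with value
  \<open>N y\<close>.\<close>

lemma abs_wedge_le: "\<bar>wedge x y\<bar> \<le> N x * N y"
proof (cases "y = 0")
  case False
  then have w: "0 < wedge y (J y)" "J y \<noteq> 0" using wedge_J_pos N_J[OF False] by auto
  have o: "orth (J y) y" using orth_J[OF False] orth_sym by blast
  have "\<bar>wedge (J y) y\<bar> = N y"
    using wedge_J[OF False] w wedge_swap[of y "J y"] by simp
  then show ?thesis using wedge_le_of_orth[OF o, of x] N_J[OF False] by (simp add: mult.commute)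
qed simp

text \<open>Equality would let one functional of norm 1 take the value 1 at both \<open>p\<close>
  and \<open>q\<close>, the vectors \<open>u\<close> and \<open>v\<close> with the signs absorbed.
  By smoothness it would be the supporting functional at \<open>p\<close> with kernel spanned by
  \<open>q\<close>, which vanishes at \<open>q\<close>.\<close>

lemma strictly_convex:
  assumes uv: "N u = 1" "N v = 1" "orth u v" and ab: "a \<noteq> 0" "b \<noteq> 0"
  shows "N (a *\<^sub>R u + b *\<^sub>R v) < \<bar>a\<bar> + \<bar>b\<bar>"
proof (rule ccontr)
  define x where "x = a *\<^sub>R u + b *\<^sub>R v"
  assume "\<not> N (a *\<^sub>R u + b *\<^sub>R v) < \<bar>a\<bar> + \<bar>b\<bar>"
  then have Nx: "\<bar>a\<bar> + \<bar>b\<bar> \<le> N x" by (simp add: x_def)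
  define p where "p = sgn a *\<^sub>R u"
  define q where "q = sgn b *\<^sub>R v"
  have Npq: "N p = 1" "N q = 1" using uv ab by (auto simp: p_def q_def N_scaleR abs_sgn_eq)
  have x: "x = \<bar>a\<bar> *\<^sub>R p + \<bar>b\<bar> *\<^sub>R q" by (simp add: x_def p_def q_def abs_mult_sgn)
  have "x \<noteq> 0" using Nx ab by auto
  define y where "y = J x"
  have y: "N y = 1" "wedge x y = N x" using N_J wedge_J \<open>x \<noteq> 0\<close> by (auto simp: y_def)
  have le: "\<bar>wedge z y\<bar> \<le> N z" for z using abs_wedge_le[of z y] y by simp
  have 1: "\<bar>a\<bar> * wedge p y \<le> \<bar>a\<bar> * 1" "\<bar>b\<bar> * wedge q y \<le> \<bar>b\<bar> * 1"
    using le[of p] le[of q] Npq by (intro mult_left_mono; linarith)+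
  moreover have "\<bar>a\<bar> + \<bar>b\<bar> \<le> \<bar>a\<bar> * wedge p y + \<bar>b\<bar> * wedge q y"
    using Nx y(2) by (simp add: x)
  ultimately have "\<bar>a\<bar> * wedge p y = \<bar>a\<bar>" "\<bar>b\<bar> * wedge q y = \<bar>b\<bar>" by linarith+
  then have 2: "wedge p y = 1" "wedge q y = 1" using ab by auto
  have "supporting_functional UNIV N p (\<lambda>z. wedge z y)"
    using le 2 by (simp add: supporting_functional_def)
  moreover have "supporting_functional UNIV N p (\<lambda>z. wedge z q / wedge p q)"
  proof (rule supporting_functional_wedge)
    show "orth p q" unfolding p_def q_def using uv(3) by (rule orth_scaleR)
  qed (use Npq in auto)
  ultimately have "wedge q y = wedge q q / wedge p q"
    using Npq(1) by (rule supporting_functional_unique)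
  then show False using 2 by simp
qed

end

section \<open>Orthogonal diagonals force the Euclidean norm\<close>

locale radon_norm_diag = radon_norm +
  assumes diag: "N u = 1 \<Longrightarrow> N v = 1 \<Longrightarrow> orth u v \<Longrightarrow> orth (u - v) (u + v)"
begin

text \<open>The diagonals span twice the area of \<open>u\<close> and \<open>J u\<close>, and the
  area of a positively oriented orthogonal pair is the product of its norms.\<close>

lemma orth_sum_diff:
  assumes "N u = 1"
  shows "orth (u + J u) (J u - u)" "wedge (u + J u) (J u - u) = 2"
    "N (u + J u) * N (J u - u) = 2"
proof -
  have u: "u \<noteq> 0" using assms by auto
  have "orth (u + J u) (u - J u)" using diag assms N_J orth_J u orth_sym by blast
  from orth_scaleR[OF this, of 1 "-1"] show o: "orth (u + J u) (J u - u)" by simp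
  show w: "wedge (u + J u) (J u - u) = 2"
    using wedge_J[OF u] wedge_swap[of u "J u"] assms by simp
  show "N (u + J u) * N (J u - u) = 2" using dual_unit_normalize(2)[OF o] w by simp
qed

text \<open>Over a half turn \<open>U t + W t\<close> changes sign, so by the intermediate value
  theorem it is parallel to \<open>z\<close> at some \<open>t\<close>. The sign left open is
  harmless because \<open>J\<close> is odd.\<close>

lemma exists_midpoint:
  assumes "N z = 1"
  obtains u where "N u = 1" "z = (1 / N (u + J u)) *\<^sub>R (u + J u)
      \<or> z = - ((1 / N (u + J u)) *\<^sub>R (u + J u))"
proof -
  define h where "h t = wedge (U t + W t) z" for t
  have h: "continuous_on {0..pi} h" unfolding h_def by (intro continuous_intros)
  have "h pi = - h 0"
    using U_add_pi[of 0] W_add_pi[of 0] by (simp add: h_def)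
  then have "\<exists>t. h t = 0"
    using IVT'[of h 0 0 pi] IVT2'[of h pi 0 0] h pi_ge_zero by (cases "h 0 \<le> 0") auto
  then obtain t where t: "wedge (U t + W t) z = 0" by (auto simp: h_def)
  define x where "x = U t + J (U t)"
  have "x \<noteq> 0" 
    using orth_sum_diff(3)[OF N_U[of t]] by (metis mult_zero_left nrm_zero x_def zero_neq_numeral)
  then have p: "0 < N x" using N_pos by blast
  have "wedge x (J x) *\<^sub>R z = wedge z (J x) *\<^sub>R x"
    using wedge_cramer[of x "J x" z] t by (simp add: x_def W_def)
  then have e: "N x *\<^sub>R z = wedge z (J x) *\<^sub>R x" using wedge_J[OF \<open>x \<noteq> 0\<close>] by simp
  then have "N (N x *\<^sub>R z) = N (wedge z (J x) *\<^sub>R x)" by simp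
  then have k: "\<bar>wedge z (J x)\<bar> = 1" using p assms by (simp add: N_scaleR)
  have "z = (1 / N x) *\<^sub>R (N x *\<^sub>R z)" using p by simp
  also have "\<dots> = wedge z (J x) *\<^sub>R ((1 / N x) *\<^sub>R x)" unfolding e by simp
  finally have z: "z = wedge z (J x) *\<^sub>R ((1 / N x) *\<^sub>R x)" .
  have "wedge z (J x) = 1 \<or> wedge z (J x) = - 1" using k by linarith
  then have "z = (1 / N x) *\<^sub>R x \<or> z = - ((1 / N x) *\<^sub>R x)"
    using z by (metis scaleR_minus1_left scaleR_one)
  then show ?thesis using that[of "U t"] N_U by (simp add: x_def)
qed

text \<open>Passing from \<open>u\<close> to the direction of \<open>u + J u\<close> brings \<open>N (u + J u)\<close> strictly closer to
  \<open>sqrt 2\<close>; as every direction arises in this way, the maximum of \<open>N (u + J u)\<close> must be \<open>sqrt 2\<close>.\<close>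

lemma N_sum_J:
  assumes "N u = 1"
  shows "N (u + J u) = sqrt 2"
proof -
  have "continuous_on {-pi..pi} (\<lambda>t. N (U t + W t))" by (intro continuous_intros)
  then have "\<exists>s\<in>{-pi..pi}. \<forall>t\<in>{-pi..pi}. N (U t + W t) \<le> N (U s + W s)"
    by (intro continuous_attains_sup) auto
  then obtain s where s: "\<And>t. t \<in> {-pi..pi} \<Longrightarrow> N (U t + W t) \<le> N (U s + W s)"
    by blast
  define R where "R = N (U s + J (U s))"
  have R: "N (x + J x) \<le> R" if "N x = 1" for x
    using obtain_U[OF that] s by (metis R_def W_def atLeastAtMost_iff)
  \<comment> \<open>As \<open>J (J x) = - x\<close>, this is the previous bound at
    \<open>J x\<close>.\<close>
  have R': "N (J x - x) \<le> R" if "N x = 1" for x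
    using R[of "J x"] J_J[OF that] N_J[of x] that by fastforce
  have "R = sqrt 2"
  proof -
    obtain x where x: "N x = 1" and z: "U s = (1 / N (x + J x)) *\<^sub>R (x + J x)
      \<or> U s = - ((1 / N (x + J x)) *\<^sub>R (x + J x))"
      using exists_midpoint[OF N_U] by blast
    define r where "r = N (x + J x)"
    define w where "w = (1 / r) *\<^sub>R (x + J x)"
    note os = orth_sum_diff[OF x]
    have "x \<noteq> 0" using x by auto
    have "x + J x \<noteq> 0" using os(3) by (metis mult_zero_left nrm_zero zero_neq_numeral)
    then have r: "0 < r" unfolding r_def using N_pos by blast
    then have w0: "w \<noteq> 0" using \<open>x + J x \<noteq> 0\<close> by (simp add: w_def)
    have d: "N (J x - x) = 2 / r" using os(3) r by (simp add: r_def field_simps)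
    \<comment> \<open>The direction is that of \<open>J x - x\<close>, whose norm is
      \<open>2 / r\<close>; hence the factor \<open>r / 2\<close>.\<close>
    have "J w = J (x + J x)" unfolding w_def using r \<open>x + J x \<noteq> 0\<close> by (intro J_scaleR) auto
    also have "\<dots> = (r / 2) *\<^sub>R (J x - x)"
      using dual_unit_normalize(1)[OF os(1)] os(2) d by simp
    finally have Jw: "w + J w = (1 / r - r / 2) *\<^sub>R x + (1 / r + r / 2) *\<^sub>R J x"
      by (simp add: w_def algebra_simps)
    have "R = N (w + J w)"
    proof (cases "U s = w")
      case False
      then have "U s = - w" using z by (simp add: w_def r_def)
      then have "U s + J (U s) = - (w + J w)" using J_minus[OF w0] by simp
      then show ?thesis by (simp only: R_def N_minus)
    qed (simp add: R_def)
    then have RN: "R = N ((1 / r - r / 2) *\<^sub>R x + (1 / r + r / 2) *\<^sub>R J x)" by (simp add: Jw)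
    show ?thesis
    proof (cases "1 / r - r / 2 = 0")
      case True
      then have "r\<^sup>2 = 2" using r by (simp add: field_simps power2_eq_square)
      then have "r = sqrt 2" using r by (simp add: real_sqrt_unique)
      moreover have "1 / r + r / 2 = r" using True by simp
      then have "R = N (r *\<^sub>R J x)" using RN unfolding True by simp
      then have "R = r" using N_J[OF \<open>x \<noteq> 0\<close>] r by (simp add: N_scaleR)
      ultimately show ?thesis by simp
    next
      case False
      \<comment> \<open>The right-hand side is the larger of \<open>r\<close> and
        \<open>2 / r\<close>, the norms of \<open>x + J x\<close> and \<open>J x - x\<close>, and
        neither exceeds the maximum \<open>R\<close>.\<close>
      have "R < \<bar>1 / r - r / 2\<bar> + \<bar>1 / r + r / 2\<bar>"
        unfolding RN using False r N_J orth_J \<open>x \<noteq> 0\<close> x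
        by (intro strictly_convex) (auto simp: add_pos_pos less_imp_neq[symmetric])
      moreover have "r \<le> R" using R[OF x] by (simp add: r_def)
      moreover have "1 / r + 1 / r \<le> R" using R'[OF x] d by simp
      moreover have "0 < 1 / r" using r by simp
      ultimately have False using r by linarith
      then show ?thesis ..
    qed
  qed
  then have 1: "N (u + J u) \<le> sqrt 2" "N (J u - u) \<le> sqrt 2" using R R' assms by auto
  have "sqrt 2 * sqrt 2 = N (u + J u) * N (J u - u)" using orth_sum_diff(3)[OF assms] by simp
  also have "\<dots> \<le> N (u + J u) * sqrt 2" using 1 N_nonneg by (intro mult_left_mono)
  finally have "sqrt 2 \<le> N (u + J u)" by (rule mult_right_le_imp_le) simp
  then show ?thesis using 1 by simp
qed

text \<open>All diagonals have norm \<open>sqrt 2\<close>, so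
  \<open>wedge (U a + W a) (W b - U b) \<le> 2\<close>; expanding this for \<open>(s, t)\<close> and
  \<open>(t, s)\<close> gives both signs. It carries the area speed of \<open>U\<close> over to
  \<open>W\<close>.\<close>

lemma wedge_defect:
  "\<bar>wedge (U s) (U t) - wedge (W s) (W t)\<bar> \<le> 2 - wedge (U t) (W s) - wedge (U s) (W t)"
proof -
  have N1: "N (U r + W r) = sqrt 2" for r unfolding W_def using N_sum_J N_U by blast
  have N2: "N (W r - U r) = sqrt 2" for r
  proof -
    have "sqrt 2 * N (W r - U r) = sqrt 2 * sqrt 2"
      using orth_sum_diff(3)[OF N_U[of r]] N1[of r] by (simp add: W_def)
    then show ?thesis using mult_left_cancel[of "sqrt 2" "N (W r - U r)" "sqrt 2"] by (simp del: real_sqrt_mult_self)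
  qed
  have "wedge (U a + W a) (W b - U b) \<le> 2" for a b
    using abs_wedge_le[of "U a + W a" "W b - U b"] by (simp add: N1 N2)
  from this[of s t] this[of t s] show ?thesis
    using wedge_swap[of "U s" "U t"] wedge_swap[of "W s" "W t"]
      wedge_swap[of "U s" "W t"] wedge_swap[of "U t" "W s"] by simp
qed

text \<open>With \<open>0 < ?c t, ?d t \<le> 1\<close>, each of \<open>1 - ?c t\<close> and
  \<open>1 - ?d t\<close> is at most \<open>1 - ?c t * ?d t\<close>, which is a product of two
  increments by the Pluecker relation. \<open>wedge_defect\<close> then bounds
  \<open>?A t - ?B t\<close> by twice that product.\<close>

lemma wedge_quotients:
  shows "((\<lambda>t. (wedge (U t) (W s) - 1) / (t - s)) \<longlongrightarrow> 0) (at s)"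
    and "((\<lambda>t. (wedge (U s) (W t) - 1) / (t - s)) \<longlongrightarrow> 0) (at s)"
    and "((\<lambda>t. wedge (W s) (W t) / (t - s)) \<longlongrightarrow> 1 / (N (cis s))\<^sup>2) (at s)"
proof -
  let ?A = "\<lambda>t. wedge (U s) (U t)" and ?B = "\<lambda>t. wedge (W s) (W t)"
  let ?c = "\<lambda>t. wedge (U t) (W s)" and ?d = "\<lambda>t. wedge (U s) (W t)"
  let ?E = "\<lambda>t. \<bar>?A t / (t - s)\<bar> * \<bar>?B t\<bar>"
  have "eventually (\<lambda>t. \<bar>?c t - 1\<bar> \<le> \<bar>?A t\<bar> * \<bar>?B t\<bar> \<and> \<bar>?d t - 1\<bar> \<le> \<bar>?A t\<bar> * \<bar>?B t\<bar> \<and>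
      \<bar>?A t - ?B t\<bar> \<le> 2 * (\<bar>?A t\<bar> * \<bar>?B t\<bar>)) (at s)"
    using eventually_wedge_U_W_pos[of s]
  proof eventually_elim
    case (elim t)
    have le: "?c t \<le> 1" "?d t \<le> 1" using wedge_U_W_le[of t s] wedge_U_W_le[of s t] wedge_U_W[of s] wedge_U_W[of t] by auto
    have "1 - ?c t * ?d t \<le> \<bar>?A t\<bar> * \<bar>?B t\<bar>"
      using wedge_plucker[of "U s" "U t" "W s" "W t"] wedge_U_W by (simp flip: abs_mult)
    moreover have "?c t * ?d t \<le> ?c t" "?c t * ?d t \<le> ?d t"
      using le elim by (simp_all add: mult_left_le mult_left_le_one_le)
    ultimately show ?case using le wedge_defect[of s t] by linarith
  qed
  then have ev: "eventually (\<lambda>t. norm ((?c t - 1) / (t - s)) \<le> ?E t \<and> norm ((?d t - 1) / (t - s)) \<le> ?E t \<and>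
      norm ((?A t - ?B t) / (t - s)) \<le> ?E t * 2) (at s)"
  proof eventually_elim
    case (elim t)
    have "x \<le> k * (\<bar>?A t\<bar> * \<bar>?B t\<bar>) \<Longrightarrow> x / \<bar>t - s\<bar> \<le> k * ?E t" for x k
      using divide_right_mono[of x "k * (\<bar>?A t\<bar> * \<bar>?B t\<bar>)" "\<bar>t - s\<bar>"] by (simp add: abs_divide)
    from this[of _ 1] this[of _ 2] show ?case
      using elim by (simp add: abs_divide mult.commute)
  qed
  note lim = wedge_area_quotient[of s]
  show "((\<lambda>t. (?c t - 1) / (t - s)) \<longlongrightarrow> 0) (at s)"
    by (rule Lim_null_comparison[OF _ lim]) (use ev in eventually_elim, simp)
  show "((\<lambda>t. (?d t - 1) / (t - s)) \<longlongrightarrow> 0) (at s)"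
    by (rule Lim_null_comparison[OF _ lim]) (use ev in eventually_elim, simp)
  have "((\<lambda>t. (?A t - ?B t) / (t - s)) \<longlongrightarrow> 0) (at s)"
    by (rule Lim_null_comparison[OF _ tendsto_mult_left_zero[OF lim, of 2]]) (use ev in eventually_elim, simp)
  from tendsto_diff[OF wedge_U_quotient this]
  show "((\<lambda>t. ?B t / (t - s)) \<longlongrightarrow> 1 / (N (cis s))\<^sup>2) (at s)"
    by (simp add: diff_divide_distrib)
qed

text \<open>The coordinates of \<open>U t\<close> and \<open>W t\<close> in the basis
  \<open>U s\<close>, \<open>W s\<close> of area 1 are the areas differentiated above. Testing
  against linear functionals keeps the derivatives real.\<close>

lemma
  fixes f :: "complex \<Rightarrow> real"
  assumes f: "linear f"
  shows has_derivative_U: "((\<lambda>t. f (U t)) has_real_derivative f (W s) / (N (cis s))\<^sup>2) (at s)"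
    and has_derivative_W: "((\<lambda>t. f (W t)) has_real_derivative - f (U s) / (N (cis s))\<^sup>2) (at s)"
proof -
  have U: "U t = wedge (U t) (W s) *\<^sub>R U s + wedge (U s) (U t) *\<^sub>R W s" for t
    using wedge_cramer[of "U s" "W s" "U t"] by (simp add: wedge_U_W)
  have W: "W t = (- wedge (W s) (W t)) *\<^sub>R U s + wedge (U s) (W t) *\<^sub>R W s" for t
    using wedge_cramer[of "U s" "W s" "W t"] wedge_swap[of "W s" "W t"] by (simp add: wedge_U_W)
  have fU: "f (U t) = wedge (U t) (W s) * f (U s) + wedge (U s) (U t) * f (W s)" for t
    by (subst U) (simp add: linear_add[OF f] linear_scale[OF f])
  have fW: "f (W t) = - wedge (W s) (W t) * f (U s) + wedge (U s) (W t) * f (W s)" for t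
    by (subst W) (simp add: linear_add[OF f] linear_diff[OF f] linear_scale[OF f] linear_neg[OF f])
  have "((\<lambda>t. (wedge (U t) (W s) - 1) / (t - s) * f (U s) + wedge (U s) (U t) / (t - s) * f (W s))
      \<longlongrightarrow> 0 * f (U s) + 1 / (N (cis s))\<^sup>2 * f (W s)) (at s)"
    by (intro tendsto_intros wedge_quotients wedge_U_quotient)
  then show "((\<lambda>t. f (U t)) has_real_derivative f (W s) / (N (cis s))\<^sup>2) (at s)"
    unfolding has_field_derivative_iff
    by (subst fU) (simp add: diff_divide_distrib add_divide_distrib algebra_simps)
  have "((\<lambda>t. - (wedge (W s) (W t) / (t - s)) * f (U s) + (wedge (U s) (W t) - 1) / (t - s) * f (W s))
      \<longlongrightarrow> - (1 / (N (cis s))\<^sup>2) * f (U s) + 0 * f (W s)) (at s)"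
    by (intro tendsto_intros wedge_quotients)
  then show "((\<lambda>t. f (W t)) has_real_derivative - f (U s) / (N (cis s))\<^sup>2) (at s)"
    unfolding has_field_derivative_iff
    by (subst fW) (simp add: diff_divide_distrib add_divide_distrib algebra_simps)
qed

text \<open>The first integral of the rotation: the two terms of the derivative cancel.\<close>

lemma linear_sum_squares:
  fixes f :: "complex \<Rightarrow> real"
  assumes "linear f"
  shows "(f (U t))\<^sup>2 + (f (W t))\<^sup>2 = (f 1)\<^sup>2 + (f \<i>)\<^sup>2"
proof -
  define h where "h t = (f (U t))\<^sup>2 + (f (W t))\<^sup>2" for t
  have "(h has_real_derivative 0) (at s)" for s
    unfolding h_def
    by (rule derivative_eq_intros has_derivative_U[OF assms] has_derivative_W[OF assms] refl)+ simp
  then have "h t = h 0" using DERIV_isconst_all by blast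
  then show ?thesis by (simp add: h_def U_zero W_zero)
qed

lemma N_eq_cmod: "N z = cmod z"
proof -
  have "N (cis t) = 1" for t
  proof -
    have 1: "(Re (U t))\<^sup>2 + (Re (W t))\<^sup>2 = 1" "(Im (U t))\<^sup>2 + (Im (W t))\<^sup>2 = 1"
      using linear_sum_squares[of Re t] linear_sum_squares[of Im t]
      by (simp_all add: bounded_linear.linear bounded_linear_Re bounded_linear_Im)
    have "Re (U t) * Im (W t) - Im (U t) * Re (W t) = 1" using wedge_U_W[of t] by (simp add: wedge_def)
    \<comment> \<open>The left-hand side is the sum of the four squares minus twice the area, that
      is \<open>2 - 2\<close>. So \<open>W t\<close> is the Euclidean quarter turn of
      \<open>U t\<close>.\<close>
    with 1 have "(Re (W t) + Im (U t))\<^sup>2 + (Re (U t) - Im (W t))\<^sup>2 = 0"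
      by (simp add: power2_eq_square algebra_simps)
    then have "Re (W t) = - Im (U t)"
      by (simp add: sum_power2_eq_zero_iff eq_neg_iff_add_eq_0)
    with 1 have "cmod (U t) = 1" by (simp add: cmod_def)
    then show ?thesis using N_cis_pos[of t] by (simp add: U_def)
  qed
  moreover have "z = cmod z *\<^sub>R cis (Arg z)"
    using rcis_cmod_Arg[of z] by (simp add: rcis_def scaleR_conv_of_real)
  ultimately show ?thesis by (metis N_scaleR abs_norm_cancel mult.right_neutral)
qed

end

section \<open>Transfer to abstract planes\<close>

lemma radon_plane_dim_at_least_2:
  assumes "radon_plane V nrm"
  shows "dim_at_least_2 V"
  using assms basis_exists[of V] unfolding radon_plane_def dim_at_least_2_def by metis

text \<open>Completeness is carried over together with the inner product, since
  \<open>radon_plane\<close> speaks only of a normed space.\<close>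

lemma hilbert_space_on_isometry:
  fixes \<phi> :: "complex \<Rightarrow> 'a::real_vector"
  assumes V: "normed_space_on V nrm" "range \<phi> = V" and lin: "linear \<phi>"
    and N: "\<And>z. nrm (\<phi> z) = cmod z"
  shows "hilbert_space_on V nrm"
proof -
  interpret normed_space_on V nrm by fact
  have "inj \<phi>"
  proof (rule injI)
    fix x y assume "\<phi> x = \<phi> y"
    then have "cmod (x - y) = 0" using N[of "x - y"] by (simp add: linear_diff[OF lin])
    then show "x = y" by simp
  qed
  then have inv: "inv \<phi> (\<phi> z) = z" for z by (rule inv_f_f)
  define ip where "ip x y = inv \<phi> x \<bullet> inv \<phi> y" for x y
  have "inner_product_on V ip"
    unfolding inner_product_on_def V(2)[symmetric] ip_def
    by (auto simp: inv inner_commute linear_add[OF lin, symmetric] linear_scale[OF lin, symmetric]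
        linear_0[OF lin] inner_add_left inner_add_right simp del: complex_scaleR)
  moreover have "nrm x = sqrt (ip x x)" if "x \<in> V" for x
    using that N unfolding V(2)[symmetric] by (auto simp: ip_def inv norm_eq_sqrt_inner)
  ultimately have "norm_induced_by_inner_product V nrm"
    unfolding norm_induced_by_inner_product_def by blast
  moreover have "banach_space_on V nrm"
  proof
    fix s :: "nat \<Rightarrow> 'a"
    assume s: "\<And>n. s n \<in> V" and c: "\<And>e. e > 0 \<Longrightarrow> \<exists>M. \<forall>m\<ge>M. \<forall>n\<ge>M. nrm (s m - s n) < e"
    define z where "z n = inv \<phi> (s n)" for n
    have sz: "s n = \<phi> (z n)" for n using s[of n] V(2) by (simp add: z_def f_inv_into_f)
    have "Cauchy z"
      unfolding Cauchy_def using c by (simp add: dist_norm sz N flip: linear_diff[OF lin])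
    then obtain l where "z \<longlonglongrightarrow> l" using Cauchy_convergent convergent_def by blast
    then have "(\<lambda>n. nrm (s n - \<phi> l)) \<longlonglongrightarrow> 0"
      by (simp add: sz N LIM_zero tendsto_norm_zero flip: linear_diff[OF lin])
    then show "\<exists>l\<in>V. (\<lambda>n. nrm (s n - l)) \<longlonglongrightarrow> 0" using V(2) by blast
  qed
  ultimately show ?thesis by (simp add: hilbert_space_on_def)
qed

lemma smooth_radon_plane_hilbert:
  fixes V :: "'a::real_vector set"
  assumes radon: "radon_plane V nrm" and smooth: "smooth_space V nrm"
    and diag: "\<forall>u\<in>unit_sphere V nrm. \<forall>v\<in>unit_sphere V nrm.
      birkhoff_orth nrm u v \<longrightarrow> birkhoff_orth nrm (u - v) (u + v)"
  shows "hilbert_space_on V nrm"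
proof -
  interpret normed_space_on V nrm using radon by (simp add: radon_plane_def)
  obtain B where B: "B \<subseteq> V" "independent B" "V \<subseteq> span B" "card B = 2"
    using radon basis_exists[of V] unfolding radon_plane_def by metis
  then obtain x y where xy: "B = {x, y}" "x \<noteq> y" by (auto simp: card_2_iff)
  obtain e f where ef: "e \<in> unit_sphere V nrm" "f \<in> unit_sphere V nrm" "birkhoff_orth nrm e f"
    and sp: "{x, y} \<subseteq> span {e, f}"
    using exists_orth_unit_pair[of x y] B xy by auto
  have ef': "e \<in> V" "f \<in> V" "nrm e = 1" "nrm f = 1" using ef by (auto simp: unit_sphere_def)
  have fe: "birkhoff_orth nrm f e" using radon ef' ef(3) unfolding radon_plane_def by blast
  define \<phi> where "\<phi> z = Re z *\<^sub>R e + Im z *\<^sub>R f" for z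
  have lin: "linear \<phi>"
    by (rule linearI) (simp_all add: \<phi>_def algebra_simps)
  have \<phi>V: "\<phi> z \<in> V" for z using ef' by (simp add: \<phi>_def)
  have "V \<subseteq> range \<phi>"
  proof
    fix v assume "v \<in> V"
    then have "v \<in> span {e, f}" using B(3) xy sp span_minimal[OF sp] by blast
    then obtain a b where "v = a *\<^sub>R e + b *\<^sub>R f"
      unfolding span_breakdown_eq by (auto simp: algebra_simps)
    then have "v = \<phi> (Complex a b)" by (simp add: \<phi>_def)
    then show "v \<in> range \<phi>" by blast
  qed
  then have range: "range \<phi> = V" using \<phi>V by blast
  define N where "N z = nrm (\<phi> z)" for z
  \<comment> \<open>Orthogonality in both orders bounds both coordinates. This gives definiteness of
    \<open>N\<close>, and from it injectivity of \<open>\<phi>\<close>.\<close>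
  have Re_le: "\<bar>Re z\<bar> \<le> N z" and Im_le: "\<bar>Im z\<bar> \<le> N z" for z
    using birkhoff_orth_le[OF ef'(1,2) ef(3), of "Re z" "Im z"]
      birkhoff_orth_le[OF ef'(2,1) fe, of "Im z" "Re z"] ef' by (simp_all add: N_def \<phi>_def add.commute)
  interpret N: normed_space_on UNIV N
  proof
    show "N z = 0 \<longleftrightarrow> z = 0" for z
      using Re_le[of z] Im_le[of z] by (auto simp: complex_eq_iff N_def \<phi>_def)
  qed (use \<phi>V nrm_triangle nrm_scaleR in
      \<open>auto simp: N_def linear_add[OF lin] linear_scale[OF lin] simp del: complex_scaleR\<close>)
  have orth: "birkhoff_orth N z w \<longleftrightarrow> birkhoff_orth nrm (\<phi> z) (\<phi> w)" for z w
    by (simp add: birkhoff_orth_def N_def linear_add[OF lin] linear_scale[OF lin])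
  have "inj \<phi>"
  proof (rule injI)
    fix z w assume "\<phi> z = \<phi> w"
    then have "N (z - w) = 0" by (simp add: N_def linear_diff[OF lin])
    then show "z = w" using N.nrm_eq_zero by simp
  qed
  then have inv: "inv \<phi> (\<phi> z) = z" for z by (rule inv_f_f)
  \<comment> \<open>Functionals move from the coordinates to \<open>V\<close>, so uniqueness in
    \<open>V\<close> gives uniqueness in the coordinates.\<close>
  have supp: "supporting_functional V nrm (\<phi> u) (\<lambda>x. h (inv \<phi> x))"
    if "supporting_functional UNIV N u h" for u h
    using that unfolding supporting_functional_def range[symmetric] N_def
    by (auto simp: inv linear_add[OF lin, symmetric] linear_scale[OF lin, symmetric]
        simp del: complex_scaleR)
  interpret radon_norm_diag N
  proof
    show "birkhoff_orth N z w \<Longrightarrow> birkhoff_orth N w z" for z w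
      using radon \<phi>V unfolding orth radon_plane_def by blast
    show "smooth_space UNIV N"
      unfolding smooth_space_def
    proof (intro ballI allI impI, elim conjE)
      fix u g h z
      assume u: "u \<in> unit_sphere UNIV N"
        and gh: "supporting_functional UNIV N u g" "supporting_functional UNIV N u h"
      have "\<phi> u \<in> unit_sphere V nrm" using u \<phi>V by (simp add: unit_sphere_def N_def)
      then have "g (inv \<phi> (\<phi> z)) = h (inv \<phi> (\<phi> z))"
        using smooth supp[OF gh(1)] supp[OF gh(2)] \<phi>V[of z] unfolding smooth_space_def by blast
      then show "g z = h z" by (simp add: inv)
    qed
    show "N 1 = 1" "N \<i> = 1" "birkhoff_orth N 1 \<i>"
      using ef' ef(3) by (simp_all add: orth N_def \<phi>_def)
    show "birkhoff_orth N (u - v) (u + v)" if "N u = 1" "N v = 1" "birkhoff_orth N u v" for u v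
      using that diag \<phi>V by (simp add: orth N_def unit_sphere_def linear_add[OF lin] linear_diff[OF lin])
  qed
  show ?thesis
    using normed_space_on_axioms range lin
    by (rule hilbert_space_on_isometry) (simp flip: N_def add: N_eq_cmod)
qed

theorem corollary2p11:
  fixes C :: "('a::real_vector set \<times> ('a \<Rightarrow> real)) set"
  assumes banach: "\<And>V nrm. (V, nrm) \<in> C \<Longrightarrow> banach_space_on V nrm \<and> dim_at_least_2 V"
    and characterizes: "\<And>V nrm. (V, nrm) \<in> C \<Longrightarrow>
      (\<forall>u\<in>unit_sphere V nrm. \<forall>v\<in>unit_sphere V nrm.
         birkhoff_orth nrm u v \<longrightarrow> birkhoff_orth nrm (u - v) (u + v))
      \<longleftrightarrow> norm_induced_by_inner_product V nrm"
  shows "(\<forall>V nrm. (V, nrm) \<in> C \<longrightarrow> (DR_B V nrm = 1 \<longleftrightarrow> hilbert_space_on V nrm)) \<and>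
    (\<forall>(V :: 'a set) nrm. radon_plane V nrm \<and> smooth_space V nrm \<longrightarrow>
       (DR_B V nrm = 1 \<longleftrightarrow> hilbert_space_on V nrm))"
proof (intro conjI allI impI)
  fix V nrm
  assume C: "(V, nrm) \<in> C"
  then have b: "banach_space_on V nrm" "dim_at_least_2 V" using banach by blast+
  then interpret banach_space_on V nrm by blast
  show "DR_B V nrm = 1 \<longleftrightarrow> hilbert_space_on V nrm"
    unfolding DR_B_eq_one_iff[OF b(2)] characterizes[OF C] hilbert_space_on_def using b(1) by simp
next
  fix V :: "'a set" and nrm
  assume r: "radon_plane V nrm \<and> smooth_space V nrm"
  then interpret normed_space_on V nrm by (simp add: radon_plane_def)
  \<comment> \<open>For smooth Radon planes the characterization of inner product norms is itself
    established, by one lemma for each direction.\<close>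
  show "DR_B V nrm = 1 \<longleftrightarrow> hilbert_space_on V nrm"
    unfolding DR_B_eq_one_iff[OF radon_plane_dim_at_least_2[OF conjunct1[OF r]]]
    using r smooth_radon_plane_hilbert inner_product_orth_diff_sum
    unfolding hilbert_space_on_def by blast
qed

end
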